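(* Let $\mathcal C$ be a category with finite limits, and let $\mathcal Z$ be a mono-coreflective subcategory of $\mathcal C$. Then the following are equivalent: (i) $\mathcal C$ is $\mathcal Z$-prenormal; (ii) the pair $(\mathcal Z\text{-}\mathrm{NEpi},\mathcal Z\text{-}\mathrm{TKer})$ is a stable factorisation system on $\mathcal C$. If moreover $\mathcal Z$ is subreflective in $\mathcal C$, then the following are also equivalent to (i) and (ii): (iii) $\mathcal C$ admits a stable factorisation system of the form $(\mathcal Z\text{-}\mathrm{NEpi},\mathscr M)$ for some class $\mathscr M$ of morphisms in $\mathcal C$; (iv) $\mathcal C$ admits a stable factorisation system of the form $(\mathscr E,\mathcal Z\text{-}\mathrm{TKer})$ for some class $\mathscr E$ of morphisms in $\mathcal C$.
   Context: Let $\mathcal C$ be a category and $\mathcal Z$ a class of objects, identified with the full subcategory it spans. A morphism is $\mathcal Z$-trivial if it factors through an object of $\mathcal Z$. A $\mathcal Z$-kernel of $f\colon A\to B$ is a morphism $k\colon K\to A$ such that $f\circ k$ is $\mathcal Z$-trivial and every $x\colon X\to A$ with $f\circ x$ $\mathcal Z$-trivial factors uniquely through $k$; $\mathcal Z$-cokernels are defined dually. A $\mathcal Z$-normal epimorphism is a morphism that is a $\mathcal Z$-cokernel of some morphism; $\mathcal Z\text{-}\mathrm{NEpi}$ is the class of these. $\mathcal Z\text{-}\mathrm{TKer}$ is the class of morphisms whose $\mathcal Z$-kernel exists and is a $\mathcal Z$-trivial morphism. $\mathcal Z$ is mono-coreflective in $\mathcal C$ if it is a full coreflective subcategory, closed under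 isomorphisms, whose coreflection counits $SX\to X$ are monomorphisms. $\mathcal Z$ is subreflective in $\mathcal C$ if, denoting by $\mathcal C^{\to\mathcal Z}$ the full subcategory of those objects that admit a morphism into some object of $\mathcal Z$, every object of $\mathcal C^{\to\mathcal Z}$ admits a reflection into $\mathcal Z$. $\mathcal C$ is $\mathcal Z$-prenormal if: (0) $\mathcal Z$ is mono-coreflective in $\mathcal C$; (1) $\mathcal C$ has finite limits; (2) every $\mathcal Z$-kernel has a $\mathcal Z$-cokernel; (3) $\mathcal Z$-normal epimorphisms are stable under pullback along arbitrary morphisms. A factorisation system on $\mathcal C$ is a pair $(\mathscr E,\mathscr M)$ of classes of morphisms such that: both classes are closed under composition with isomorphisms; every morphism $f$ factors as $f=m\circ e$ with $e\in\mathscr E$, $m\in\mathscr M$; and for every $f\colon X\to Y$ in $\mathscr E$, $f'\colon X'\to Y'$ in $\mathscr M$, $x\colon X\to X'$, $y\colon Y\to Y'$ with $y\circ f=f'\circ x$ there is a unique $d\colon Y\to X'$ with $d\circ f=x$ and $f'\circ d=y$. It is stable if the pullback of a morphism of $\mathscr E$ along any morphism is again in $\mathscr E$. *)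

theory Defs
  imports Main
begin

text \<open>Categories with explicit sets of objects and arrows. The operations are total HOL
  functions; their values outside the indicated domains are irrelevant.
  The composite \<open>Comp C g f\<close> is read \<open>g \<circ> f\<close>.\<close>

record ('o, 'a) cat =
  Obj :: "'o set"
  Arr :: "'a set"
  Dom :: "'a \<Rightarrow> 'o"
  Cod :: "'a \<Rightarrow> 'o"
  Ident :: "'o \<Rightarrow> 'a"
  Comp :: "'a \<Rightarrow> 'a \<Rightarrow> 'a"  (infixr "\<cdot>\<index>" 70)

definition hom :: "('o, 'a) cat \<Rightarrow> 'o \<Rightarrow> 'o \<Rightarrow> 'a set" where
  "hom C A B = {f \<in> Arr C. Dom C f = A \<and> Cod C f = B}"

locale category =
  fixes C :: "('o, 'a) cat" (structure)
  assumes dom_obj: "f \<in> Arr C \<Longrightarrow> Dom C f \<in> Obj C"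
    and cod_obj: "f \<in> Arr C \<Longrightarrow> Cod C f \<in> Obj C"
    and ident_hom: "A \<in> Obj C \<Longrightarrow> Ident C A \<in> hom C A A"
    and comp_hom: "\<lbrakk>f \<in> hom C A B; g \<in> hom C B D\<rbrakk> \<Longrightarrow> g \<cdot> f \<in> hom C A D"
    and comp_ident: "f \<in> hom C A B \<Longrightarrow> f \<cdot> Ident C A = f"
    and ident_comp: "f \<in> hom C A B \<Longrightarrow> Ident C B \<cdot> f = f"
    and comp_assoc: "\<lbrakk>f \<in> hom C A B; g \<in> hom C B D; h \<in> hom C D E\<rbrakk>
      \<Longrightarrow> (h \<cdot> g) \<cdot> f = h \<cdot> (g \<cdot> f)"

definition is_iso :: "('o, 'a) cat \<Rightarrow> 'a \<Rightarrow> bool" where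
  "is_iso C f \<longleftrightarrow> f \<in> Arr C \<and>
     (\<exists>g \<in> hom C (Cod C f) (Dom C f).
        g \<cdot>\<^bsub>C\<^esub> f = Ident C (Dom C f) \<and> f \<cdot>\<^bsub>C\<^esub> g = Ident C (Cod C f))"

definition is_mono :: "('o, 'a) cat \<Rightarrow> 'a \<Rightarrow> bool" where
  "is_mono C f \<longleftrightarrow> f \<in> Arr C \<and>
     (\<forall>X. \<forall>u \<in> hom C X (Dom C f). \<forall>v \<in> hom C X (Dom C f). f \<cdot>\<^bsub>C\<^esub> u = f \<cdot>\<^bsub>C\<^esub> v \<longrightarrow> u = v)"


subsection \<open>Finite limits\<close>

definition is_functor ::
  "('i, 'j) cat \<Rightarrow> ('o, 'a) cat \<Rightarrow> ('i \<Rightarrow> 'o) \<Rightarrow> ('j \<Rightarrow> 'a) \<Rightarrow> bool" where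
  "is_functor J C Fo Fa \<longleftrightarrow>
     (\<forall>i \<in> Obj J. Fo i \<in> Obj C \<and> Fa (Ident J i) = Ident C (Fo i)) \<and>
     (\<forall>s \<in> Arr J. Fa s \<in> hom C (Fo (Dom J s)) (Fo (Cod J s))) \<and>
     (\<forall>s \<in> Arr J. \<forall>t \<in> Arr J. Cod J s = Dom J t \<longrightarrow> Fa (t \<cdot>\<^bsub>J\<^esub> s) = Fa t \<cdot>\<^bsub>C\<^esub> Fa s)"

definition is_cone ::
  "('i, 'j) cat \<Rightarrow> ('o, 'a) cat \<Rightarrow> ('i \<Rightarrow> 'o) \<Rightarrow> ('j \<Rightarrow> 'a) \<Rightarrow> 'o \<Rightarrow> ('i \<Rightarrow> 'a) \<Rightarrow> bool" where
  "is_cone J C Fo Fa X c \<longleftrightarrow> X \<in> Obj C \<and>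
     (\<forall>i \<in> Obj J. c i \<in> hom C X (Fo i)) \<and>
     (\<forall>s \<in> Arr J. Fa s \<cdot>\<^bsub>C\<^esub> c (Dom J s) = c (Cod J s))"

definition is_limit ::
  "('i, 'j) cat \<Rightarrow> ('o, 'a) cat \<Rightarrow> ('i \<Rightarrow> 'o) \<Rightarrow> ('j \<Rightarrow> 'a) \<Rightarrow> 'o \<Rightarrow> ('i \<Rightarrow> 'a) \<Rightarrow> bool" where
  "is_limit J C Fo Fa L p \<longleftrightarrow> is_cone J C Fo Fa L p \<and>
     (\<forall>X c. is_cone J C Fo Fa X c \<longrightarrow>
        (\<exists>!u. u \<in> hom C X L \<and> (\<forall>i \<in> Obj J. p i \<cdot>\<^bsub>C\<^esub> u = c i)))"

text \<open>Every finite category is isomorphic to one whose objects and arrows are natural numbers,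
  so these index categories suffice.\<close>

definition has_finite_limits :: "('o, 'a) cat \<Rightarrow> bool" where
  "has_finite_limits C \<longleftrightarrow>
     (\<forall>(J :: (nat, nat) cat) Fo Fa.
        category J \<and> finite (Obj J) \<and> finite (Arr J) \<and> is_functor J C Fo Fa \<longrightarrow>
        (\<exists>L p. is_limit J C Fo Fa L p))"

text \<open>The square \<open>f \<circ> p = g \<circ> q\<close> is a pullback; \<open>q\<close> is the pullback of \<open>f\<close> along \<open>g\<close>.\<close>

definition is_pullback :: "('o, 'a) cat \<Rightarrow> 'a \<Rightarrow> 'a \<Rightarrow> 'a \<Rightarrow> 'a \<Rightarrow> bool" where
  "is_pullback C f g p q \<longleftrightarrow>
     f \<in> Arr C \<and> g \<in> Arr C \<and> Cod C f = Cod C g \<and>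
     p \<in> hom C (Dom C p) (Dom C f) \<and> q \<in> hom C (Dom C p) (Dom C g) \<and>
     f \<cdot>\<^bsub>C\<^esub> p = g \<cdot>\<^bsub>C\<^esub> q \<and>
     (\<forall>X. \<forall>x \<in> hom C X (Dom C f). \<forall>y \<in> hom C X (Dom C g). f \<cdot>\<^bsub>C\<^esub> x = g \<cdot>\<^bsub>C\<^esub> y \<longrightarrow>
        (\<exists>!u. u \<in> hom C X (Dom C p) \<and> p \<cdot>\<^bsub>C\<^esub> u = x \<and> q \<cdot>\<^bsub>C\<^esub> u = y))"

definition pullback_stable :: "('o, 'a) cat \<Rightarrow> 'a set \<Rightarrow> bool" where
  "pullback_stable C E \<longleftrightarrow> (\<forall>f g p q. f \<in> E \<and> is_pullback C f g p q \<longrightarrow> q \<in> E)"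


subsection \<open>Kernels and cokernels relative to a class of objects\<close>

definition trivial :: "('o, 'a) cat \<Rightarrow> 'o set \<Rightarrow> 'a \<Rightarrow> bool" where
  "trivial C Z f \<longleftrightarrow> f \<in> Arr C \<and>
     (\<exists>W \<in> Z. \<exists>g \<in> hom C (Dom C f) W. \<exists>h \<in> hom C W (Cod C f). f = h \<cdot>\<^bsub>C\<^esub> g)"

definition is_kernel :: "('o, 'a) cat \<Rightarrow> 'o set \<Rightarrow> 'a \<Rightarrow> 'a \<Rightarrow> bool" where
  "is_kernel C Z f k \<longleftrightarrow>
     f \<in> Arr C \<and> k \<in> Arr C \<and> Cod C k = Dom C f \<and> trivial C Z (f \<cdot>\<^bsub>C\<^esub> k) \<and>
     (\<forall>X. \<forall>x \<in> hom C X (Dom C f). trivial C Z (f \<cdot>\<^bsub>C\<^esub> x) \<longrightarrow>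
        (\<exists>!u. u \<in> hom C X (Dom C k) \<and> k \<cdot>\<^bsub>C\<^esub> u = x))"

definition is_cokernel :: "('o, 'a) cat \<Rightarrow> 'o set \<Rightarrow> 'a \<Rightarrow> 'a \<Rightarrow> bool" where
  "is_cokernel C Z f q \<longleftrightarrow>
     f \<in> Arr C \<and> q \<in> Arr C \<and> Dom C q = Cod C f \<and> trivial C Z (q \<cdot>\<^bsub>C\<^esub> f) \<and>
     (\<forall>X. \<forall>x \<in> hom C (Cod C f) X. trivial C Z (x \<cdot>\<^bsub>C\<^esub> f) \<longrightarrow>
        (\<exists>!u. u \<in> hom C (Cod C q) X \<and> u \<cdot>\<^bsub>C\<^esub> q = x))"

definition NEpi :: "('o, 'a) cat \<Rightarrow> 'o set \<Rightarrow> 'a set" where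
  "NEpi C Z = {q. \<exists>f. is_cokernel C Z f q}"

definition TKer :: "('o, 'a) cat \<Rightarrow> 'o set \<Rightarrow> 'a set" where
  "TKer C Z = {f. \<exists>k. is_kernel C Z f k \<and> trivial C Z k}"


subsection \<open>Coreflections and reflections\<close>

definition is_coreflection :: "('o, 'a) cat \<Rightarrow> 'o set \<Rightarrow> 'o \<Rightarrow> 'a \<Rightarrow> bool" where
  "is_coreflection C Z X e \<longleftrightarrow>
     e \<in> Arr C \<and> Dom C e \<in> Z \<and> Cod C e = X \<and>
     (\<forall>W \<in> Z. \<forall>f \<in> hom C W X. \<exists>!u. u \<in> hom C W (Dom C e) \<and> e \<cdot>\<^bsub>C\<^esub> u = f)"

definition is_reflection :: "('o, 'a) cat \<Rightarrow> 'o set \<Rightarrow> 'o \<Rightarrow> 'a \<Rightarrow> bool" where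
  "is_reflection C Z X r \<longleftrightarrow>
     r \<in> Arr C \<and> Dom C r = X \<and> Cod C r \<in> Z \<and>
     (\<forall>W \<in> Z. \<forall>f \<in> hom C X W. \<exists>!u. u \<in> hom C (Cod C r) W \<and> u \<cdot>\<^bsub>C\<^esub> r = f)"

definition mono_coreflective :: "('o, 'a) cat \<Rightarrow> 'o set \<Rightarrow> bool" where
  "mono_coreflective C Z \<longleftrightarrow>
     Z \<subseteq> Obj C \<and>
     (\<forall>f. is_iso C f \<and> Dom C f \<in> Z \<longrightarrow> Cod C f \<in> Z) \<and>
     (\<forall>X \<in> Obj C. \<exists>e. is_coreflection C Z X e) \<and>
     (\<forall>X \<in> Obj C. \<forall>e. is_coreflection C Z X e \<longrightarrow> is_mono C e)"

definition subreflective :: "('o, 'a) cat \<Rightarrow> 'o set \<Rightarrow> bool" where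
  "subreflective C Z \<longleftrightarrow>
     (\<forall>X \<in> Obj C. (\<exists>W \<in> Z. hom C X W \<noteq> {}) \<longrightarrow> (\<exists>r. is_reflection C Z X r))"

definition prenormal :: "('o, 'a) cat \<Rightarrow> 'o set \<Rightarrow> bool" where
  "prenormal C Z \<longleftrightarrow>
     mono_coreflective C Z \<and>
     has_finite_limits C \<and>
     (\<forall>f k. is_kernel C Z f k \<longrightarrow> (\<exists>q. is_cokernel C Z k q)) \<and>
     pullback_stable C (NEpi C Z)"


subsection \<open>Factorisation systems\<close>

definition iso_closed :: "('o, 'a) cat \<Rightarrow> 'a set \<Rightarrow> bool" where
  "iso_closed C E \<longleftrightarrow>
     (\<forall>e \<in> E. \<forall>i. is_iso C i \<longrightarrow>
        (Dom C i = Cod C e \<longrightarrow> i \<cdot>\<^bsub>C\<^esub> e \<in> E) \<and> (Cod C i = Dom C e \<longrightarrow> e \<cdot>\<^bsub>C\<^esub> i \<in> E))"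

definition factorisation_system :: "('o, 'a) cat \<Rightarrow> 'a set \<Rightarrow> 'a set \<Rightarrow> bool" where
  "factorisation_system C E M \<longleftrightarrow>
     E \<subseteq> Arr C \<and> M \<subseteq> Arr C \<and> iso_closed C E \<and> iso_closed C M \<and>
     (\<forall>f \<in> Arr C. \<exists>e \<in> E. \<exists>m \<in> M.
        Dom C e = Dom C f \<and> Cod C e = Dom C m \<and> Cod C m = Cod C f \<and> f = m \<cdot>\<^bsub>C\<^esub> e) \<and>
     (\<forall>f \<in> E. \<forall>f' \<in> M. \<forall>x \<in> hom C (Dom C f) (Dom C f'). \<forall>y \<in> hom C (Cod C f) (Cod C f').
        y \<cdot>\<^bsub>C\<^esub> f = f' \<cdot>\<^bsub>C\<^esub> x \<longrightarrow>
        (\<exists>!d. d \<in> hom C (Cod C f) (Dom C f') \<and> d \<cdot>\<^bsub>C\<^esub> f = x \<and> f' \<cdot>\<^bsub>C\<^esub> d = y))"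

definition stable_factorisation_system :: "('o, 'a) cat \<Rightarrow> 'a set \<Rightarrow> 'a set \<Rightarrow> bool" where
  "stable_factorisation_system C E M \<longleftrightarrow> factorisation_system C E M \<and> pullback_stable C E"

end

theory Submission imports Defs begin

text \<open>
  Since coreflection counits are monomorphisms, an arrow \<open>f\<close> into \<open>B\<close> is \<open>Z\<close>-trivial iff it
  factors, necessarily uniquely, through the counit \<open>e\<close> at \<open>B\<close>. Hence the pullback of \<open>e\<close> along
  \<open>f\<close> is a \<open>Z\<close>-kernel of \<open>f\<close>, all kernels exist, and both classes have descriptions in terms of
  generalised elements: \<open>TKer\<close> consists of the arrows that reflect triviality (\<open>TKer_iff\<close>), and a
  normal epimorphism \<open>q\<close> is an epimorphism through which every \<open>x\<close> factors that trivialises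
  whatever \<open>q\<close> trivialises (\<open>NEpi_epi\<close>, \<open>NEpi_factors\<close>, \<open>NEpiI\<close>). Orthogonality of \<open>NEpi\<close> and
  \<open>TKer\<close> follows at once. What prenormality adds is stability and the existence of
  factorisations.

  If \<open>C\<close> is prenormal, let \<open>q\<close> be the cokernel of the kernel of \<open>f\<close> and \<open>f = m \<circ> q\<close>. To see that
  \<open>m\<close> reflects triviality of \<open>x\<close>, pull \<open>q\<close> back along \<open>x\<close> to a normal epimorphism \<open>q'\<close>; then
  \<open>x \<circ> q'\<close> is trivial, and since \<open>q'\<close> is orthogonal to the counits, which lie in \<open>TKer\<close>, so is
  \<open>x\<close>. Conversely, if \<open>f = m \<circ> q\<close> with \<open>q\<close> normal epi and \<open>m\<close> in \<open>TKer\<close>, then \<open>f\<close> and \<open>q\<close> have the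
  same kernel, and \<open>q\<close> is its cokernel. So prenormality follows from a stable system
  \<open>(NEpi, M)\<close> as soon as \<open>M \<subseteq> TKer\<close>.

  In the subreflective case, reflections into \<open>Z\<close> are normal epimorphisms. Every arrow
  orthogonal to them reflects triviality, which settles the systems \<open>(NEpi, M)\<close>. For a stable
  system \<open>(E, TKer)\<close> it remains to prove \<open>E = NEpi\<close>. Arrows in \<open>E\<close> are epi because
  equalisers lie in \<open>TKer\<close>; and if \<open>x\<close> trivialises whatever \<open>e \<in> E\<close> trivialises, factorising
  \<open>\<langle>e, x\<rangle>\<close> into the product yields an arrow of \<open>TKer\<close> with codomain that of \<open>e\<close>, and
  orthogonality of \<open>e\<close> to it gives the factorisation of \<open>x\<close> through \<open>e\<close> (\<open>E_factors\<close>). That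
  \<open>NEpi \<subseteq> E\<close> is then the usual argument with orthogonality to the second factor.
\<close>

section \<open>Composition and finite limits\<close>

context category
begin

text \<open>The axioms of a category are phrased with \<open>hom\<close>, whose objects the simplifier would have to guess.
The versions below speak of domains and codomains instead, so that \<open>typed_simps\<close> decides typing
and reassociates composites to the right.\<close>

lemma comp_typed:
  assumes "f \<in> Arr C" "g \<in> Arr C" "Cod C f = Dom C g"
  shows "g \<cdot> f \<in> Arr C" "Dom C (g \<cdot> f) = Dom C f" "Cod C (g \<cdot> f) = Cod C g"
  using comp_hom[of f "Dom C f" "Cod C f" g "Cod C g"] assms by (simp_all add: hom_def)

lemma comp_assoc_typed:
  assumes "f \<in> Arr C" "g \<in> Arr C" "h \<in> Arr C" "Cod C f = Dom C g" "Cod C g = Dom C h"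
  shows "(h \<cdot> g) \<cdot> f = h \<cdot> (g \<cdot> f)"
  using comp_assoc[of f "Dom C f" "Cod C f" g "Cod C g" h "Cod C h"] assms by (simp add: hom_def)

lemma ident_typed:
  assumes "A \<in> Obj C"
  shows "Ident C A \<in> Arr C" "Dom C (Ident C A) = A" "Cod C (Ident C A) = A"
  using ident_hom[OF assms] by (simp_all add: hom_def)

lemma comp_ident_typed: "f \<in> Arr C \<Longrightarrow> Dom C f = A \<Longrightarrow> f \<cdot> Ident C A = f"
  using comp_ident[of f A "Cod C f"] by (simp add: hom_def)

lemma ident_comp_typed: "f \<in> Arr C \<Longrightarrow> Cod C f = A \<Longrightarrow> Ident C A \<cdot> f = f"
  using ident_comp[of f "Dom C f" A] by (simp add: hom_def)

lemmas typed_simps = hom_def comp_typed comp_assoc_typed ident_typed comp_ident_typed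
  ident_comp_typed

lemma hom_objs: "f \<in> hom C A B \<Longrightarrow> A \<in> Obj C \<and> B \<in> Obj C"
  using dom_obj cod_obj by (auto simp: hom_def)

lemma isoE:
  assumes "is_iso C i" "i \<in> hom C A B"
  obtains j where "j \<in> hom C B A" "j \<cdot> i = Ident C A" "i \<cdot> j = Ident C B"
    "\<And>X x. x \<in> hom C X A \<Longrightarrow> j \<cdot> (i \<cdot> x) = x" "\<And>X x. x \<in> hom C X B \<Longrightarrow> i \<cdot> (j \<cdot> x) = x"
proof -
  obtain j where j: "j \<in> hom C B A" "j \<cdot> i = Ident C A" "i \<cdot> j = Ident C B"
    using assms by (auto simp: is_iso_def hom_def)
  show thesis
  proof (rule that[OF j])
    fix X x assume x: "x \<in> hom C X A"
    then show "j \<cdot> (i \<cdot> x) = x" using comp_assoc[OF x assms(2) j(1)] ident_comp[OF x] j by simp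
  next
    fix X x assume x: "x \<in> hom C X B"
    then show "i \<cdot> (j \<cdot> x) = x" using comp_assoc[OF x j(1) assms(2)] ident_comp[OF x] j by simp
  qed
qed

text \<open>The common source of pullbacks, binary products and equalisers: each is the limit of a diagram
whose shape is a finite bipartite graph. Such a graph is a category once identities are added,
because no two of its edges compose.\<close>

lemma bipartite_limit:
  fixes n m :: nat and s t :: "nat \<Rightarrow> nat"
  assumes lim: "has_finite_limits C"
    and objs: "\<And>i. i < n \<Longrightarrow> F i \<in> Obj C"
    and edges: "\<And>k. k < m \<Longrightarrow> s k < n \<and> t k < n \<and> a k \<in> hom C (F (s k)) (F (t k))"
    and bipartite: "\<And>k l. k < m \<Longrightarrow> l < m \<Longrightarrow> t k \<noteq> s l"
  obtains L p where
    "\<And>i. i < n \<Longrightarrow> p i \<in> hom C L (F i)"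
    "\<And>k. k < m \<Longrightarrow> a k \<cdot> p (s k) = p (t k)"
    "\<And>X c. X \<in> Obj C \<Longrightarrow> (\<And>i. i < n \<Longrightarrow> c i \<in> hom C X (F i)) \<Longrightarrow>
      (\<And>k. k < m \<Longrightarrow> a k \<cdot> c (s k) = c (t k)) \<Longrightarrow>
      \<exists>!u. u \<in> hom C X L \<and> (\<forall>i<n. p i \<cdot> u = c i)"
proof -
  \<comment> \<open>Arrow \<open>i < n\<close> is the identity of \<open>i\<close>, and arrow \<open>n + k\<close> is edge \<open>k\<close>.\<close>
  define J :: "(nat, nat) cat" where "J =
    \<lparr>Obj = {..<n}, Arr = {..<n + m},
     Dom = (\<lambda>x. if x < n then x else s (x - n)),
     Cod = (\<lambda>x. if x < n then x else t (x - n)),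
     Ident = (\<lambda>x. x), Comp = (\<lambda>y x. if y < n then x else y)\<rparr>"
  define Fa where "Fa x = (if x < n then Ident C (F x) else a (x - n))" for x
  have e: "s (x - n) < n" "t (x - n) < n" "a (x - n) \<in> hom C (F (s (x - n))) (F (t (x - n)))"
    if "x < n + m" "\<not> x < n" for x
    using edges[of "x - n"] that by auto
  have b: "t (x - n) \<noteq> s (y - n)" if "x < n + m" "\<not> x < n" "y < n + m" "\<not> y < n" for x y
    using bipartite[of "x - n" "y - n"] that by auto
  have J: "category J"
    by unfold_locales (auto simp: J_def hom_def e b split: if_splits dest: b)
  have Obj_J: "Obj J = {..<n}" by (simp add: J_def)
  have fin: "finite (Obj J)" "finite (Arr J)" by (simp_all add: J_def)
  have Fa_typed: "Fa x \<in> hom C (F (Dom J x)) (F (Cod J x))" if "x < n + m" for x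
    using that e[of x] objs[of x] by (auto simp: Fa_def J_def ident_hom)
  have fct: "is_functor J C F Fa"
    unfolding is_functor_def
  proof (intro conjI ballI impI)
    fix x y assume x: "x \<in> Arr J" and y: "y \<in> Arr J" and eq: "Cod J x = Dom J y"
    have typed: "Fa x \<in> hom C (F (Dom J x)) (F (Dom J y))" "Fa y \<in> hom C (F (Dom J y)) (F (Cod J y))"
      using Fa_typed[of x] Fa_typed[of y] x y eq by (simp_all add: J_def)
    show "Fa (y \<cdot>\<^bsub>J\<^esub> x) = Fa y \<cdot> Fa x"
    proof (cases "y < n")
      case True
      then show ?thesis using ident_comp[OF typed(1)] by (simp add: J_def Fa_def)
    next
      case False
      then have "x < n" using x y eq b[of x y] by (auto simp: J_def split: if_splits)
      then show ?thesis using False eq comp_ident[OF typed(2)] by (simp add: J_def Fa_def)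
    qed
  qed (use Fa_typed objs in \<open>auto simp: J_def Fa_def\<close>)
  obtain L p where L: "is_limit J C F Fa L p"
    using lim J fin fct unfolding has_finite_limits_def by blast
  have cone_iff: "is_cone J C F Fa X c \<longleftrightarrow> X \<in> Obj C \<and> (\<forall>i<n. c i \<in> hom C X (F i)) \<and>
      (\<forall>k<m. a k \<cdot> c (s k) = c (t k))" (is "_ \<longleftrightarrow> ?rhs") for X c
  proof
    assume l: "is_cone J C F Fa X c"
    then have "a k \<cdot> c (s k) = c (t k)" if "k < m" for k
      using that unfolding is_cone_def by (auto simp: J_def Fa_def dest!: bspec[where x = "n + k"])
    then show ?rhs using l by (auto simp: is_cone_def J_def)
  next
    assume r: ?rhs
    have "Fa x \<cdot> c (Dom J x) = c (Cod J x)" if "x < n + m" for x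
    proof (cases "x < n")
      case True
      then show ?thesis using r ident_comp[of "c x" X "F x"] by (simp add: J_def Fa_def)
    next
      case False
      then show ?thesis using r that by (simp add: J_def Fa_def)
    qed
    then show "is_cone J C F Fa X c" using r by (auto simp: is_cone_def J_def)
  qed
  show thesis
  proof (rule that[of p L])
    fix X c assume "X \<in> Obj C" "\<And>i. i < n \<Longrightarrow> c i \<in> hom C X (F i)"
      "\<And>k. k < m \<Longrightarrow> a k \<cdot> c (s k) = c (t k)"
    then have "is_cone J C F Fa X c" by (simp add: cone_iff)
    then show "\<exists>!u. u \<in> hom C X L \<and> (\<forall>i<n. p i \<cdot> u = c i)"
      using L unfolding is_limit_def Obj_J by (simp add: Ball_def)
  qed (use L in \<open>auto simp: is_limit_def cone_iff\<close>)
qed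

lemma pullback_exists:
  assumes "has_finite_limits C" and f: "f \<in> hom C A B" and g: "g \<in> hom C D B"
  obtains P p q where "p \<in> hom C P A" "q \<in> hom C P D" "is_pullback C f g p q"
proof -
  define F where "F i = (if i = 0 then A else if i = 1 then D else B)" for i :: nat
  define a where "a k = (if k = 0 then f else g)" for k :: nat
  have objs: "F i \<in> Obj C" for i using hom_objs[OF f] hom_objs[OF g] by (simp add: F_def)
  obtain L p where p: "\<And>i. i < 3 \<Longrightarrow> p i \<in> hom C L (F i)"
    and sq: "\<And>k. k < 2 \<Longrightarrow> a k \<cdot> p k = p 2"
    and un: "\<And>X c. X \<in> Obj C \<Longrightarrow> (\<And>i. i < 3 \<Longrightarrow> c i \<in> hom C X (F i)) \<Longrightarrow>
      (\<And>k. k < 2 \<Longrightarrow> a k \<cdot> c k = c 2) \<Longrightarrow> \<exists>!u. u \<in> hom C X L \<and> (\<forall>i<3. p i \<cdot> u = c i)"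
    by (rule bipartite_limit[where n = 3 and m = 2 and F = F and a = a and s = "\<lambda>k. k"
          and t = "\<lambda>_. 2", OF assms(1)]) (use objs f g in \<open>auto simp: F_def a_def\<close>)
  have p0: "p 0 \<in> hom C L A" and p1: "p 1 \<in> hom C L D" using p[of 0] p[of 1] by (simp_all add: F_def)
  have eq: "f \<cdot> p 0 = p 2" "g \<cdot> p 1 = p 2" using sq[of 0] sq[of 1] by (simp_all add: a_def)
  have "\<exists>!u. u \<in> hom C X L \<and> p 0 \<cdot> u = x \<and> p 1 \<cdot> u = y"
    if x: "x \<in> hom C X A" and y: "y \<in> hom C X D" and xy: "f \<cdot> x = g \<cdot> y" for X x y
  proof -
    define c where "c i = (if i = 0 then x else if i = 1 then y else f \<cdot> x)" for i :: nat
    have *: "\<exists>!u. u \<in> hom C X L \<and> (\<forall>i<3. p i \<cdot> u = c i)"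
      by (rule un) (use x y f xy hom_objs[OF x] comp_hom[OF x f] in \<open>auto simp: c_def F_def a_def\<close>)
    have "(\<forall>i<3. p i \<cdot> u = c i) \<longleftrightarrow> p 0 \<cdot> u = x \<and> p 1 \<cdot> u = y" if u: "u \<in> hom C X L" for u
    proof -
      have "p 2 \<cdot> u = f \<cdot> (p 0 \<cdot> u)" unfolding eq(1)[symmetric] using u p0 f by (simp add: typed_simps)
      then show ?thesis by (auto simp: c_def numeral_3_eq_3 less_Suc_eq numeral_2_eq_2)
    qed
    then show ?thesis using * by (simp cong: conj_cong)
  qed
  then have "is_pullback C f g (p 0) (p 1)"
    using p0 p1 f g eq unfolding is_pullback_def by (auto simp: hom_def)
  then show thesis using that p0 p1 by blast
qed

lemma product_exists:
  assumes "has_finite_limits C" and "A \<in> Obj C" "B \<in> Obj C"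
  obtains P p q where "p \<in> hom C P A" "q \<in> hom C P B"
    "\<And>X x y. x \<in> hom C X A \<Longrightarrow> y \<in> hom C X B \<Longrightarrow> \<exists>!u. u \<in> hom C X P \<and> p \<cdot> u = x \<and> q \<cdot> u = y"
proof -
  define F where "F i = (if i = 0 then A else B)" for i :: nat
  obtain L p where p: "\<And>i. i < 2 \<Longrightarrow> p i \<in> hom C L (F i)"
    and un: "\<And>X c. X \<in> Obj C \<Longrightarrow> (\<And>i. i < 2 \<Longrightarrow> c i \<in> hom C X (F i)) \<Longrightarrow>
      \<exists>!u. u \<in> hom C X L \<and> (\<forall>i<2. p i \<cdot> u = c i)"
    by (rule bipartite_limit[where n = 2 and m = 0 and F = F, OF assms(1)])
      (use assms in \<open>auto simp: F_def\<close>)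
  show thesis
  proof (rule that[of "p 0" L "p 1"])
    fix X x y assume x: "x \<in> hom C X A" and y: "y \<in> hom C X B"
    have "\<exists>!u. u \<in> hom C X L \<and> (\<forall>i<2. p i \<cdot> u = (if i = 0 then x else y))"
      by (rule un) (use x y hom_objs[OF x] in \<open>auto simp: F_def\<close>)
    then show "\<exists>!u. u \<in> hom C X L \<and> p 0 \<cdot> u = x \<and> p 1 \<cdot> u = y"
      by (simp add: numeral_2_eq_2 less_Suc_eq all_conj_distrib imp_disjL imp_conjR)
  qed (use p[of 0] p[of 1] in \<open>auto simp: F_def\<close>)
qed

lemma equalizer_exists:
  assumes "has_finite_limits C" and u: "u \<in> hom C A B" and v: "v \<in> hom C A B"
  obtains P i where "i \<in> hom C P A" "u \<cdot> i = v \<cdot> i"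
    "\<And>X x. x \<in> hom C X A \<Longrightarrow> u \<cdot> x = v \<cdot> x \<Longrightarrow> \<exists>!w. w \<in> hom C X P \<and> i \<cdot> w = x"
proof -
  define F where "F i = (if i = 0 then A else B)" for i :: nat
  define a where "a k = (if k = 0 then u else v)" for k :: nat
  obtain L p where p: "\<And>i. i < 2 \<Longrightarrow> p i \<in> hom C L (F i)"
    and sq: "\<And>k. k < 2 \<Longrightarrow> a k \<cdot> p 0 = p 1"
    and un: "\<And>X c. X \<in> Obj C \<Longrightarrow> (\<And>i. i < 2 \<Longrightarrow> c i \<in> hom C X (F i)) \<Longrightarrow>
      (\<And>k. k < 2 \<Longrightarrow> a k \<cdot> c 0 = c 1) \<Longrightarrow> \<exists>!w. w \<in> hom C X L \<and> (\<forall>i<2. p i \<cdot> w = c i)"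
    by (rule bipartite_limit[where n = 2 and m = 2 and F = F and a = a and s = "\<lambda>_. 0"
          and t = "\<lambda>_. 1", OF assms(1)]) (use u v hom_objs[OF u] in \<open>auto simp: F_def a_def\<close>)
  have p0: "p 0 \<in> hom C L A" using p[of 0] by (simp add: F_def)
  have eq: "u \<cdot> p 0 = p 1" "v \<cdot> p 0 = p 1" using sq[of 0] sq[of 1] by (simp_all add: a_def)
  show thesis
  proof (rule that[of "p 0" L])
    fix X x assume x: "x \<in> hom C X A" and uv: "u \<cdot> x = v \<cdot> x"
    define c where "c i = (if i = 0 then x else u \<cdot> x)" for i :: nat
    have *: "\<exists>!w. w \<in> hom C X L \<and> (\<forall>i<2. p i \<cdot> w = c i)"
      by (rule un) (use x u uv hom_objs[OF x] comp_hom[OF x u] in \<open>auto simp: c_def F_def a_def\<close>)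
    have "(\<forall>i<2. p i \<cdot> w = c i) \<longleftrightarrow> p 0 \<cdot> w = x" if w: "w \<in> hom C X L" for w
    proof -
      have "p 1 \<cdot> w = u \<cdot> (p 0 \<cdot> w)" unfolding eq(1)[symmetric] using w p0 u by (simp add: typed_simps)
      then show ?thesis by (auto simp: c_def less_Suc_eq numeral_2_eq_2)
    qed
    then show "\<exists>!w. w \<in> hom C X L \<and> p 0 \<cdot> w = x" using * by (simp cong: conj_cong)
  qed (use p0 eq in auto)
qed

end

section \<open>Trivial arrows, kernels and normal epimorphisms\<close>

locale mono_coreflective_subcategory = category C for C :: "('o, 'a) cat" (structure) +
  fixes Z :: "'o set"
  assumes finite_limits: "has_finite_limits C"
    and mono_coreflective: "mono_coreflective C Z"
begin

lemma trivialI: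
  assumes "g \<in> hom C A W" "W \<in> Z" "h \<in> hom C W B"
  shows "trivial C Z (h \<cdot> g)"
  using assms unfolding trivial_def by (auto simp: typed_simps)

lemma trivialE:
  assumes "trivial C Z f" "f \<in> hom C A B"
  obtains W g h where "W \<in> Z" "g \<in> hom C A W" "h \<in> hom C W B" "f = h \<cdot> g"
  using assms unfolding trivial_def by (auto simp: hom_def)

lemma trivial_comp_left:
  assumes f: "f \<in> hom C A B" and g: "g \<in> hom C B D" and "trivial C Z f"
  shows "trivial C Z (g \<cdot> f)"
proof -
  obtain W a b where W: "W \<in> Z" and a: "a \<in> hom C A W" and b: "b \<in> hom C W B" and eq: "f = b \<cdot> a"
    using trivialE[OF assms(3) f] .
  have "g \<cdot> f = (g \<cdot> b) \<cdot> a" using a b g by (simp add: eq typed_simps)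
  then show ?thesis using trivialI[OF a W comp_hom[OF b g]] by simp
qed

lemma trivial_comp_right:
  assumes f: "f \<in> hom C A B" and g: "g \<in> hom C B D" and "trivial C Z g"
  shows "trivial C Z (g \<cdot> f)"
proof -
  obtain W a b where W: "W \<in> Z" and a: "a \<in> hom C B W" and b: "b \<in> hom C W D" and eq: "g = b \<cdot> a"
    using trivialE[OF assms(3) g] .
  have "g \<cdot> f = b \<cdot> (a \<cdot> f)" using a b f by (simp add: eq typed_simps)
  then show ?thesis using trivialI[OF comp_hom[OF f a] W b] by simp
qed

lemma trivial_into_Z: "f \<in> hom C A W \<Longrightarrow> W \<in> Z \<Longrightarrow> trivial C Z f"
  using trivialI[of f A W "Ident C W" W] hom_objs[of f A W] by (simp add: typed_simps)

text \<open>Every trivial arrow into \<open>X\<close> passes through some object of \<open>Z\<close>, hence through the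
coreflection of \<open>X\<close>.\<close>

lemma coreflectionE:
  assumes "X \<in> Obj C"
  obtains W e where "W \<in> Z" "e \<in> hom C W X"
    "\<And>Y u v. u \<in> hom C Y W \<Longrightarrow> v \<in> hom C Y W \<Longrightarrow> e \<cdot> u = e \<cdot> v \<Longrightarrow> u = v"
    "\<And>Y x. x \<in> hom C Y X \<Longrightarrow> trivial C Z x \<Longrightarrow> \<exists>u \<in> hom C Y W. e \<cdot> u = x"
proof -
  obtain e where e: "is_coreflection C Z X e"
    using mono_coreflective assms unfolding mono_coreflective_def by blast
  then have mono: "is_mono C e"
    using mono_coreflective assms unfolding mono_coreflective_def by blast
  have e_hom: "e \<in> hom C (Dom C e) X" "Dom C e \<in> Z" using e by (simp_all add: is_coreflection_def hom_def)
  show thesis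
  proof (rule that[OF e_hom(2,1)])
    fix Y x assume x: "x \<in> hom C Y X" and "trivial C Z x"
    then obtain W g h where W: "W \<in> Z" and g: "g \<in> hom C Y W" and h: "h \<in> hom C W X"
      and eq: "x = h \<cdot> g" using trivialE by blast
    then obtain u where u: "u \<in> hom C W (Dom C e)" "e \<cdot> u = h"
      using e unfolding is_coreflection_def by blast
    have "e \<cdot> (u \<cdot> g) = x" unfolding eq u(2)[symmetric] using e_hom u(1) g by (simp add: typed_simps)
    then show "\<exists>u \<in> hom C Y (Dom C e). e \<cdot> u = x" using comp_hom[OF g u(1)] by blast
  qed (use mono in \<open>auto simp: is_mono_def\<close>)
qed

lemma kernelE:
  assumes "is_kernel C Z f k" "f \<in> hom C A B"
  obtains K where "k \<in> hom C K A" "trivial C Z (f \<cdot> k)"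
    "\<And>X x. x \<in> hom C X A \<Longrightarrow> trivial C Z (f \<cdot> x) \<Longrightarrow> \<exists>!u. u \<in> hom C X K \<and> k \<cdot> u = x"
  using assms unfolding is_kernel_def by (auto simp: hom_def)

text \<open>The kernel is the pullback along \<open>f\<close> of the coreflection counit \<open>e\<close>. As \<open>e\<close> is mono,
the second projection of the pullback is determined by the first, which gives uniqueness.\<close>

lemma kernel_exists:
  assumes f: "f \<in> hom C A B"
  obtains K k where "is_kernel C Z f k" "k \<in> hom C K A"
proof -
  obtain W e where W: "W \<in> Z" and e: "e \<in> hom C W B"
    and mono: "\<And>Y u v. u \<in> hom C Y W \<Longrightarrow> v \<in> hom C Y W \<Longrightarrow> e \<cdot> u = e \<cdot> v \<Longrightarrow> u = v"
    and lift: "\<And>Y x. x \<in> hom C Y B \<Longrightarrow> trivial C Z x \<Longrightarrow> \<exists>u \<in> hom C Y W. e \<cdot> u = x"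
    using coreflectionE[of B] hom_objs[OF f] by metis
  obtain K k k' where k: "k \<in> hom C K A" and k': "k' \<in> hom C K W" and pb: "is_pullback C f e k k'"
    using pullback_exists[OF finite_limits f e] .
  have sq: "f \<cdot> k = e \<cdot> k'" using pb by (simp add: is_pullback_def)
  have "\<exists>!u. u \<in> hom C X K \<and> k \<cdot> u = x" if x: "x \<in> hom C X A" and t: "trivial C Z (f \<cdot> x)" for X x
  proof -
    obtain w where w: "w \<in> hom C X W" "e \<cdot> w = f \<cdot> x" using lift[OF comp_hom[OF x f] t] by blast
    have ex: "\<exists>!u. u \<in> hom C X K \<and> k \<cdot> u = x \<and> k' \<cdot> u = w"
    proof -
      have "Dom C k = K" "Dom C f = A" "Dom C e = W" using k f e by (simp_all add: hom_def)
      then show ?thesis using pb x w unfolding is_pullback_def by simp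
    qed
    have "k' \<cdot> u = w" if u: "u \<in> hom C X K" and "k \<cdot> u = x" for u
    proof (rule mono[OF comp_hom[OF u k'] w(1)])
      have "e \<cdot> (k' \<cdot> u) = (f \<cdot> k) \<cdot> u" unfolding sq using u e k' by (simp add: typed_simps)
      also have "\<dots> = f \<cdot> (k \<cdot> u)" using u f k by (simp add: typed_simps)
      finally show "e \<cdot> (k' \<cdot> u) = e \<cdot> w" using that w by simp
    qed
    then show ?thesis using ex by metis
  qed
  moreover have "trivial C Z (f \<cdot> k)" unfolding sq by (rule trivialI[OF k' W e])
  ultimately have "is_kernel C Z f k" using f k by (auto simp: is_kernel_def hom_def)
  then show thesis using that k by blast
qed

text \<open>An arrow \<open>x\<close> with \<open>f \<circ> x\<close> trivial factors through the kernel of \<open>f\<close>; so if the kernel is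
trivial, then \<open>x\<close> is too. Conversely the kernel is itself such an \<open>x\<close>.\<close>

lemma TKer_iff:
  assumes f: "f \<in> hom C A B"
  shows "f \<in> TKer C Z \<longleftrightarrow> (\<forall>X. \<forall>x \<in> hom C X A. trivial C Z (f \<cdot> x) \<longrightarrow> trivial C Z x)"
proof
  assume "f \<in> TKer C Z"
  then obtain k where k: "is_kernel C Z f k" and t: "trivial C Z k" by (auto simp: TKer_def)
  obtain K where k_hom: "k \<in> hom C K A"
    and un: "\<And>X x. x \<in> hom C X A \<Longrightarrow> trivial C Z (f \<cdot> x) \<Longrightarrow> \<exists>!u. u \<in> hom C X K \<and> k \<cdot> u = x"
    using kernelE[OF k f] by metis
  show "\<forall>X. \<forall>x \<in> hom C X A. trivial C Z (f \<cdot> x) \<longrightarrow> trivial C Z x"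
    using un trivial_comp_right[OF _ k_hom t] by metis
next
  assume r: "\<forall>X. \<forall>x \<in> hom C X A. trivial C Z (f \<cdot> x) \<longrightarrow> trivial C Z x"
  obtain K k where k: "is_kernel C Z f k" "k \<in> hom C K A" using kernel_exists[OF f] by metis
  then show "f \<in> TKer C Z" using r by (auto simp: TKer_def is_kernel_def)
qed

lemma TKer_subset_Arr: "TKer C Z \<subseteq> Arr C"
  by (auto simp: TKer_def is_kernel_def)

lemma NEpi_subset_Arr: "NEpi C Z \<subseteq> Arr C"
  by (auto simp: NEpi_def is_cokernel_def)

lemma cokernelE:
  assumes "is_cokernel C Z f q" "q \<in> hom C B Q"
  obtains A where "f \<in> hom C A B" "trivial C Z (q \<cdot> f)"
    "\<And>X x. x \<in> hom C B X \<Longrightarrow> trivial C Z (x \<cdot> f) \<Longrightarrow> \<exists>!u. u \<in> hom C Q X \<and> u \<cdot> q = x"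
  using assms unfolding is_cokernel_def by (auto simp: hom_def)

lemma cokernelI:
  assumes "f \<in> hom C A B" "q \<in> hom C B Q" "trivial C Z (q \<cdot> f)"
    "\<And>X x. x \<in> hom C B X \<Longrightarrow> trivial C Z (x \<cdot> f) \<Longrightarrow> \<exists>!u. u \<in> hom C Q X \<and> u \<cdot> q = x"
  shows "is_cokernel C Z f q"
  using assms unfolding is_cokernel_def by (auto simp: hom_def)

text \<open>Cokernels are epi because trivial arrows form an ideal: \<open>u \<circ> q\<close> composed with the arrow that
\<open>q\<close> trivialises stays trivial, so the uniqueness clause applies to \<open>u\<close> and \<open>v\<close>.\<close>

lemma NEpi_epi:
  assumes q: "q \<in> NEpi C Z" "q \<in> hom C A Q" and u: "u \<in> hom C Q X" and v: "v \<in> hom C Q X"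
    and eq: "u \<cdot> q = v \<cdot> q"
  shows "u = v"
proof -
  obtain f where f: "is_cokernel C Z f q" using q by (auto simp: NEpi_def)
  obtain Y where f_hom: "f \<in> hom C Y A" and t: "trivial C Z (q \<cdot> f)"
    and un: "\<And>X x. x \<in> hom C A X \<Longrightarrow> trivial C Z (x \<cdot> f) \<Longrightarrow> \<exists>!u. u \<in> hom C Q X \<and> u \<cdot> q = x"
    using cokernelE[OF f q(2)] by metis
  have "(u \<cdot> q) \<cdot> f = u \<cdot> (q \<cdot> f)" using f_hom q u by (simp add: typed_simps)
  then have "trivial C Z ((u \<cdot> q) \<cdot> f)" using trivial_comp_left[OF comp_hom[OF f_hom q(2)] u t] by simp
  then show ?thesis using un[OF comp_hom[OF q(2) u]] u v eq by metis
qed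

lemma NEpi_factors:
  assumes q: "q \<in> NEpi C Z" "q \<in> hom C A Q" and x: "x \<in> hom C A X"
    and t: "\<And>Y y. y \<in> hom C Y A \<Longrightarrow> trivial C Z (q \<cdot> y) \<Longrightarrow> trivial C Z (x \<cdot> y)"
  shows "\<exists>u \<in> hom C Q X. u \<cdot> q = x"
proof -
  obtain f where f: "is_cokernel C Z f q" using q by (auto simp: NEpi_def)
  show ?thesis using cokernelE[OF f q(2)] t x by metis
qed

text \<open>The kernel \<open>k\<close> of \<open>f\<close> is generic among the arrows that \<open>f\<close>, equivalently \<open>q\<close>,
trivialises. An arrow that trivialises \<open>k\<close> therefore trivialises all of them.\<close>

lemma cokernel_of_kernelI:
  assumes q: "q \<in> hom C A Q" and f: "f \<in> hom C A B" and k: "is_kernel C Z f k"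
    and same: "\<And>Y y. y \<in> hom C Y A \<Longrightarrow> trivial C Z (q \<cdot> y) \<longleftrightarrow> trivial C Z (f \<cdot> y)"
    and epi: "\<And>X u v. u \<in> hom C Q X \<Longrightarrow> v \<in> hom C Q X \<Longrightarrow> u \<cdot> q = v \<cdot> q \<Longrightarrow> u = v"
    and factors: "\<And>X x. x \<in> hom C A X \<Longrightarrow>
      (\<And>Y y. y \<in> hom C Y A \<Longrightarrow> trivial C Z (q \<cdot> y) \<Longrightarrow> trivial C Z (x \<cdot> y)) \<Longrightarrow>
      \<exists>u \<in> hom C Q X. u \<cdot> q = x"
  shows "is_cokernel C Z k q"
proof -
  obtain K where k_hom: "k \<in> hom C K A" and kt: "trivial C Z (f \<cdot> k)"
    and un: "\<And>X x. x \<in> hom C X A \<Longrightarrow> trivial C Z (f \<cdot> x) \<Longrightarrow> \<exists>!u. u \<in> hom C X K \<and> k \<cdot> u = x"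
    using kernelE[OF k f] by metis
  show ?thesis
  proof (rule cokernelI[OF k_hom q])
    show "trivial C Z (q \<cdot> k)" using same[OF k_hom] kt by simp
  next
    fix X x assume x: "x \<in> hom C A X" and t: "trivial C Z (x \<cdot> k)"
    have "\<exists>u \<in> hom C Q X. u \<cdot> q = x"
    proof (rule factors[OF x])
      fix Y y assume y: "y \<in> hom C Y A" and "trivial C Z (q \<cdot> y)"
      then obtain u where u: "u \<in> hom C Y K" "k \<cdot> u = y" using un same by metis
      have "x \<cdot> y = (x \<cdot> k) \<cdot> u" unfolding u(2)[symmetric] using x k_hom u(1) by (simp add: typed_simps)
      then show "trivial C Z (x \<cdot> y)" using trivial_comp_right[OF u(1) comp_hom[OF k_hom x] t] by simp
    qed
    then show "\<exists>!u. u \<in> hom C Q X \<and> u \<cdot> q = x" using epi by metis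
  qed
qed

text \<open>With \<open>NEpi_epi\<close> and \<open>NEpi_factors\<close> this characterises normal epimorphisms without
mentioning an arrow of which they are the cokernel.\<close>

lemma NEpiI:
  assumes q: "q \<in> hom C A Q"
    and epi: "\<And>X u v. u \<in> hom C Q X \<Longrightarrow> v \<in> hom C Q X \<Longrightarrow> u \<cdot> q = v \<cdot> q \<Longrightarrow> u = v"
    and factors: "\<And>X x. x \<in> hom C A X \<Longrightarrow>
      (\<And>Y y. y \<in> hom C Y A \<Longrightarrow> trivial C Z (q \<cdot> y) \<Longrightarrow> trivial C Z (x \<cdot> y)) \<Longrightarrow>
      \<exists>u \<in> hom C Q X. u \<cdot> q = x"
  shows "q \<in> NEpi C Z"
proof -
  obtain k where k: "is_kernel C Z q k" using kernel_exists[OF q] by metis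
  have "is_cokernel C Z k q"
    by (rule cokernel_of_kernelI[OF q q k refl]) (use epi factors in blast)+
  then show ?thesis by (auto simp: NEpi_def)
qed

lemma trivial_TKer_comp:
  assumes "m \<in> TKer C Z" and m: "m \<in> hom C A B" and x: "x \<in> hom C X A"
  shows "trivial C Z (m \<cdot> x) \<longleftrightarrow> trivial C Z x"
  using assms TKer_iff[OF m] trivial_comp_left[OF x m] by blast

text \<open>Since \<open>m\<close> reflects triviality, \<open>q\<close> trivialises the same arrows as \<open>m \<circ> q\<close>.\<close>

lemma NEpi_TKer_factor_cokernel:
  assumes q: "q \<in> NEpi C Z" "q \<in> hom C A Q" and m: "m \<in> TKer C Z" "m \<in> hom C Q B"
    and k: "is_kernel C Z (m \<cdot> q) k"
  shows "is_cokernel C Z k q"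
proof (rule cokernel_of_kernelI[OF q(2) comp_hom[OF q(2) m(2)] k])
  fix Y y assume y: "y \<in> hom C Y A"
  have "(m \<cdot> q) \<cdot> y = m \<cdot> (q \<cdot> y)" using m q y by (simp add: typed_simps)
  then show "trivial C Z (q \<cdot> y) \<longleftrightarrow> trivial C Z ((m \<cdot> q) \<cdot> y)"
    using trivial_TKer_comp[OF m comp_hom[OF y q(2)]] by simp
qed (use NEpi_epi[OF q] NEpi_factors[OF q] in blast)+


section \<open>Orthogonality\<close>

definition orthogonal :: "'a \<Rightarrow> 'a \<Rightarrow> bool" where
  "orthogonal f f' \<longleftrightarrow>
     (\<forall>x \<in> hom C (Dom C f) (Dom C f'). \<forall>y \<in> hom C (Cod C f) (Cod C f').
        y \<cdot> f = f' \<cdot> x \<longrightarrow>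
        (\<exists>!d. d \<in> hom C (Cod C f) (Dom C f') \<and> d \<cdot> f = x \<and> f' \<cdot> d = y))"

lemma orthogonalD:
  assumes "orthogonal f f'" "f \<in> hom C A B" "f' \<in> hom C A' B'" "x \<in> hom C A A'" "y \<in> hom C B B'"
    "y \<cdot> f = f' \<cdot> x"
  obtains d where "d \<in> hom C B A'" "d \<cdot> f = x" "f' \<cdot> d = y"
proof -
  have "Dom C f = A" "Cod C f = B" "Dom C f' = A'" "Cod C f' = B'"
    using assms by (simp_all add: hom_def)
  then show thesis using assms that unfolding orthogonal_def by metis
qed

text \<open>A restatement that names the middle object of the factorisation and isolates orthogonality.\<close>

lemma factorisation_system_iff:
  "factorisation_system C E M \<longleftrightarrow>
     E \<subseteq> Arr C \<and> M \<subseteq> Arr C \<and> iso_closed C E \<and> iso_closed C M \<and>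
     (\<forall>A B. \<forall>f \<in> hom C A B. \<exists>e \<in> E. \<exists>m \<in> M. \<exists>Q. e \<in> hom C A Q \<and> m \<in> hom C Q B \<and> f = m \<cdot> e) \<and>
     (\<forall>e \<in> E. \<forall>m \<in> M. orthogonal e m)"
proof -
  have "(\<forall>f \<in> Arr C. \<exists>e \<in> E. \<exists>m \<in> M.
        Dom C e = Dom C f \<and> Cod C e = Dom C m \<and> Cod C m = Cod C f \<and> f = m \<cdot> e) \<longleftrightarrow>
     (\<forall>A B. \<forall>f \<in> hom C A B. \<exists>e \<in> E. \<exists>m \<in> M. \<exists>Q. e \<in> hom C A Q \<and> m \<in> hom C Q B \<and> f = m \<cdot> e)"
    if "E \<subseteq> Arr C" "M \<subseteq> Arr C"
  proof (intro iffI allI ballI)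
    fix A B f
    assume l: "\<forall>f \<in> Arr C. \<exists>e \<in> E. \<exists>m \<in> M.
        Dom C e = Dom C f \<and> Cod C e = Dom C m \<and> Cod C m = Cod C f \<and> f = m \<cdot> e"
      and f: "f \<in> hom C A B"
    then obtain e m where em: "e \<in> E" "m \<in> M" "Dom C e = A" "Cod C e = Dom C m" "Cod C m = B" "f = m \<cdot> e"
      by (auto simp: hom_def)
    then have "e \<in> hom C A (Cod C e)" "m \<in> hom C (Cod C e) B" using that by (auto simp: hom_def)
    then show "\<exists>e \<in> E. \<exists>m \<in> M. \<exists>Q. e \<in> hom C A Q \<and> m \<in> hom C Q B \<and> f = m \<cdot> e"
      using em by blast
  next
    fix f
    assume r: "\<forall>A B. \<forall>f \<in> hom C A B. \<exists>e \<in> E. \<exists>m \<in> M. \<exists>Q. e \<in> hom C A Q \<and> m \<in> hom C Q B \<and> f = m \<cdot> e"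
      and "f \<in> Arr C"
    then have "f \<in> hom C (Dom C f) (Cod C f)" by (simp add: hom_def)
    then obtain e m Q where em: "e \<in> E" "m \<in> M" "e \<in> hom C (Dom C f) Q" "m \<in> hom C Q (Cod C f)" "f = m \<cdot> e"
      using r by blast
    then have "Dom C e = Dom C f \<and> Cod C e = Dom C m \<and> Cod C m = Cod C f"
      by (simp add: hom_def)
    then show "\<exists>e \<in> E. \<exists>m \<in> M.
        Dom C e = Dom C f \<and> Cod C e = Dom C m \<and> Cod C m = Cod C f \<and> f = m \<cdot> e"
      using em by blast
  qed
  then show ?thesis unfolding factorisation_system_def orthogonal_def by (simp cong: conj_cong)
qed

text \<open>If \<open>q\<close> trivialises \<open>v\<close>, then \<open>m \<circ> x \<circ> v = y \<circ> q \<circ> v\<close> is trivial, hence so is \<open>x \<circ> v\<close>, and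
\<open>x\<close> factors through \<open>q\<close>. The other triangle and uniqueness hold because \<open>q\<close> is epi.\<close>

lemma NEpi_TKer_orthogonal:
  assumes "q \<in> NEpi C Z" "m \<in> TKer C Z"
  shows "orthogonal q m"
  unfolding orthogonal_def
proof (intro ballI impI)
  fix x y assume x: "x \<in> hom C (Dom C q) (Dom C m)" and y: "y \<in> hom C (Cod C q) (Cod C m)"
    and sq: "y \<cdot> q = m \<cdot> x"
  have q: "q \<in> hom C (Dom C q) (Cod C q)" and m: "m \<in> hom C (Dom C m) (Cod C m)"
    using assms NEpi_subset_Arr TKer_subset_Arr by (auto simp: hom_def)
  have "\<exists>d \<in> hom C (Cod C q) (Dom C m). d \<cdot> q = x"
  proof (rule NEpi_factors[OF assms(1) q x])
    fix Y v assume v: "v \<in> hom C Y (Dom C q)" and t: "trivial C Z (q \<cdot> v)"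
    have "m \<cdot> (x \<cdot> v) = (y \<cdot> q) \<cdot> v" unfolding sq using m x v by (simp add: typed_simps)
    also have "\<dots> = y \<cdot> (q \<cdot> v)" using y q v by (simp add: typed_simps)
    finally show "trivial C Z (x \<cdot> v)"
      using trivial_TKer_comp[OF assms(2) m comp_hom[OF v x]] trivial_comp_left[OF comp_hom[OF v q] y t]
      by simp
  qed
  then obtain d where d: "d \<in> hom C (Cod C q) (Dom C m)" "d \<cdot> q = x" by blast
  have "(m \<cdot> d) \<cdot> q = m \<cdot> (d \<cdot> q)" using m d(1) q by (simp add: typed_simps)
  then have "m \<cdot> d = y" using NEpi_epi[OF assms(1) q comp_hom[OF d(1) m] y] d(2) sq by simp
  then show "\<exists>!d. d \<in> hom C (Cod C q) (Dom C m) \<and> d \<cdot> q = x \<and> m \<cdot> d = y"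
    using d NEpi_epi[OF assms(1) q] by metis
qed

lemma from_Z_TKer: "f \<in> hom C W B \<Longrightarrow> W \<in> Z \<Longrightarrow> f \<in> TKer C Z"
  using TKer_iff trivial_into_Z by blast

text \<open>The counit \<open>e\<close> at \<open>X\<close> lies in \<open>TKer\<close> because its domain is in \<open>Z\<close>. A factorisation of
\<open>x \<circ> q\<close> through \<open>e\<close> is a square between \<open>q\<close> and \<open>e\<close>, and its diagonal factors \<open>x\<close> through \<open>e\<close>.\<close>

lemma trivial_comp_orthogonal:
  assumes orth: "\<And>m. m \<in> TKer C Z \<Longrightarrow> orthogonal q m"
    and q: "q \<in> hom C A B" and x: "x \<in> hom C B X" and t: "trivial C Z (x \<cdot> q)"
  shows "trivial C Z x"
proof -
  obtain W e where W: "W \<in> Z" and e: "e \<in> hom C W X"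
    and lift: "\<And>Y x. x \<in> hom C Y X \<Longrightarrow> trivial C Z x \<Longrightarrow> \<exists>u \<in> hom C Y W. e \<cdot> u = x"
    using coreflectionE[of X] hom_objs[OF x] by metis
  obtain w where w: "w \<in> hom C A W" "e \<cdot> w = x \<cdot> q" using lift[OF comp_hom[OF q x] t] by blast
  obtain d where d: "d \<in> hom C B W" "e \<cdot> d = x"
    using orthogonalD[OF orth[OF from_Z_TKer[OF e W]] q e w(1) x] w(2) by metis
  then show ?thesis using trivialI[OF d(1) W e] by simp
qed


section \<open>Prenormality and the factorisation system\<close>

lemma NEpi_iso_left:
  assumes q: "q \<in> NEpi C Z" "q \<in> hom C A Q" and i: "is_iso C i" "i \<in> hom C Q Q'"
  shows "i \<cdot> q \<in> NEpi C Z"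
proof (rule NEpiI[OF comp_hom[OF q(2) i(2)]])
  obtain j where j: "j \<in> hom C Q' Q" "j \<cdot> i = Ident C Q" "i \<cdot> j = Ident C Q'"
    using isoE[OF i] by metis
  {
    fix X u v assume u: "u \<in> hom C Q' X" and v: "v \<in> hom C Q' X" and "u \<cdot> (i \<cdot> q) = v \<cdot> (i \<cdot> q)"
    then have "(u \<cdot> i) \<cdot> q = (v \<cdot> i) \<cdot> q" using i q by (simp add: typed_simps)
    then have "(u \<cdot> i) \<cdot> j = (v \<cdot> i) \<cdot> j"
      using NEpi_epi[OF q comp_hom[OF i(2) u] comp_hom[OF i(2) v]] by simp
    then show "u = v" using u v i(2) j by (simp add: typed_simps)
  next
    fix X x assume x: "x \<in> hom C A X"
      and t: "\<And>Y y. y \<in> hom C Y A \<Longrightarrow> trivial C Z ((i \<cdot> q) \<cdot> y) \<Longrightarrow> trivial C Z (x \<cdot> y)"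
    have "\<exists>u \<in> hom C Q X. u \<cdot> q = x"
    proof (rule NEpi_factors[OF q x])
      fix Y y assume y: "y \<in> hom C Y A" and "trivial C Z (q \<cdot> y)"
      then have "trivial C Z (i \<cdot> (q \<cdot> y))" using trivial_comp_left[OF comp_hom[OF y q(2)] i(2)] by simp
      then show "trivial C Z (x \<cdot> y)" using t[OF y] i q y by (simp add: typed_simps)
    qed
    then obtain u where u: "u \<in> hom C Q X" "u \<cdot> q = x" by blast
    have "(u \<cdot> j) \<cdot> (i \<cdot> q) = u \<cdot> ((j \<cdot> i) \<cdot> q)" using u(1) j(1) i(2) q(2) by (simp add: typed_simps)
    also have "\<dots> = x" using u j(2) ident_comp[OF q(2)] by simp
    finally show "\<exists>u \<in> hom C Q' X. u \<cdot> (i \<cdot> q) = x" using comp_hom[OF j(1) u(1)] by blast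
  }
qed

lemma NEpi_iso_right:
  assumes q: "q \<in> NEpi C Z" "q \<in> hom C A Q" and i: "is_iso C i" "i \<in> hom C A' A"
  shows "q \<cdot> i \<in> NEpi C Z"
proof (rule NEpiI[OF comp_hom[OF i(2) q(2)]])
  obtain j where j: "j \<in> hom C A A'" "j \<cdot> i = Ident C A'" "i \<cdot> j = Ident C A"
    and cancel: "\<And>X x. x \<in> hom C X A \<Longrightarrow> i \<cdot> (j \<cdot> x) = x"
    using isoE[OF i] by metis
  {
    fix X u v assume u: "u \<in> hom C Q X" and v: "v \<in> hom C Q X" and "u \<cdot> (q \<cdot> i) = v \<cdot> (q \<cdot> i)"
    then have "(u \<cdot> (q \<cdot> i)) \<cdot> j = (v \<cdot> (q \<cdot> i)) \<cdot> j" by simp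
    then have "u \<cdot> q = v \<cdot> q" using u v i(2) j q by (simp add: typed_simps)
    then show "u = v" by (rule NEpi_epi[OF q u v])
  next
    fix X x assume x: "x \<in> hom C A' X"
      and t: "\<And>Y y. y \<in> hom C Y A' \<Longrightarrow> trivial C Z ((q \<cdot> i) \<cdot> y) \<Longrightarrow> trivial C Z (x \<cdot> y)"
    have "\<exists>u \<in> hom C Q X. u \<cdot> q = x \<cdot> j"
    proof (rule NEpi_factors[OF q comp_hom[OF j(1) x]])
      fix Y y assume y: "y \<in> hom C Y A" and qy: "trivial C Z (q \<cdot> y)"
      have "(q \<cdot> i) \<cdot> (j \<cdot> y) = q \<cdot> (i \<cdot> (j \<cdot> y))" using q i j(1) y by (simp add: typed_simps)
      then have "trivial C Z (x \<cdot> (j \<cdot> y))" using t[OF comp_hom[OF y j(1)]] qy cancel[OF y] by simp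
      then show "trivial C Z ((x \<cdot> j) \<cdot> y)" using x j(1) y by (simp add: typed_simps)
    qed
    then obtain u where u: "u \<in> hom C Q X" "u \<cdot> q = x \<cdot> j" by blast
    have "u \<cdot> (q \<cdot> i) = (u \<cdot> q) \<cdot> i" using u(1) q i by (simp add: typed_simps)
    also have "\<dots> = x" unfolding u(2) using x j i(2) by (simp add: typed_simps)
    finally show "\<exists>u \<in> hom C Q X. u \<cdot> (q \<cdot> i) = x" using u(1) by blast
  }
qed

lemma iso_closed_NEpi: "iso_closed C (NEpi C Z)"
proof -
  have "q \<in> hom C (Dom C q) (Cod C q)" if "q \<in> NEpi C Z" for q
    using that NEpi_subset_Arr by (auto simp: hom_def)
  moreover have "i \<in> hom C (Dom C i) (Cod C i)" if "is_iso C i" for i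
    using that by (simp add: is_iso_def hom_def)
  ultimately show ?thesis unfolding iso_closed_def
    using NEpi_iso_left NEpi_iso_right by metis
qed

lemma iso_TKer:
  assumes "is_iso C i"
  shows "i \<in> TKer C Z"
proof -
  have i: "i \<in> hom C (Dom C i) (Cod C i)" using assms by (simp add: is_iso_def hom_def)
  obtain j where j: "j \<in> hom C (Cod C i) (Dom C i)"
    and cancel: "\<And>X x. x \<in> hom C X (Dom C i) \<Longrightarrow> j \<cdot> (i \<cdot> x) = x"
    using isoE[OF assms i] by metis
  show ?thesis unfolding TKer_iff[OF i] using trivial_comp_left[OF comp_hom[OF _ i] j] cancel by metis
qed

lemma TKer_comp:
  assumes f: "f \<in> TKer C Z" and g: "g \<in> TKer C Z" and comp: "Cod C f = Dom C g"
  shows "g \<cdot> f \<in> TKer C Z"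
proof -
  have fh: "f \<in> hom C (Dom C f) (Dom C g)" and gh: "g \<in> hom C (Dom C g) (Cod C g)"
    using f g comp TKer_subset_Arr by (auto simp: hom_def)
  have "trivial C Z x" if x: "x \<in> hom C X (Dom C f)" and t: "trivial C Z ((g \<cdot> f) \<cdot> x)" for X x
  proof -
    have "trivial C Z (g \<cdot> (f \<cdot> x))" using t x fh gh by (simp add: typed_simps)
    then show ?thesis
      using trivial_TKer_comp[OF g gh comp_hom[OF x fh]] trivial_TKer_comp[OF f fh x] by simp
  qed
  then show ?thesis using TKer_iff[OF comp_hom[OF fh gh]] by blast
qed

lemma iso_closed_TKer: "iso_closed C (TKer C Z)"
  unfolding iso_closed_def using TKer_comp iso_TKer by simp

lemma prenormal_iff:
  "prenormal C Z \<longleftrightarrow> pullback_stable C (NEpi C Z) \<and>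
     (\<forall>f k. is_kernel C Z f k \<longrightarrow> (\<exists>q. is_cokernel C Z k q))"
  using finite_limits mono_coreflective by (auto simp: prenormal_def)

text \<open>The first factor is the cokernel of the kernel of \<open>f\<close>. Pullback stability is what makes the
second factor reflect triviality: it replaces an arrow into the middle object by one that lifts
to \<open>A\<close>.\<close>

lemma prenormal_factorisation:
  assumes pre: "prenormal C Z" and f: "f \<in> hom C A B"
  shows "\<exists>e \<in> NEpi C Z. \<exists>m \<in> TKer C Z. \<exists>Q. e \<in> hom C A Q \<and> m \<in> hom C Q B \<and> f = m \<cdot> e"
proof -
  obtain K k where k: "is_kernel C Z f k" and k_hom: "k \<in> hom C K A" using kernel_exists[OF f] by metis
  then obtain q where coker: "is_cokernel C Z k q" using pre by (auto simp: prenormal_iff)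
  define Q where "Q = Cod C q"
  have q: "q \<in> hom C A Q" using coker k_hom by (auto simp: is_cokernel_def hom_def Q_def)
  have qk: "trivial C Z (q \<cdot> k)" using coker by (simp add: is_cokernel_def)
  have N: "q \<in> NEpi C Z" using coker by (auto simp: NEpi_def)
  have un: "\<exists>!u. u \<in> hom C X K \<and> k \<cdot> u = x" if "x \<in> hom C X A" "trivial C Z (f \<cdot> x)" for X x
  proof -
    have "Dom C k = K" "Dom C f = A" using k_hom f by (simp_all add: hom_def)
    then show ?thesis using k that by (simp add: is_kernel_def)
  qed
  have "trivial C Z (f \<cdot> k)" using k by (simp add: is_kernel_def)
  then obtain m where m: "m \<in> hom C Q B" and mq: "m \<cdot> q = f"
    using cokernelE[OF coker q] f by metis
  have "trivial C Z x" if x: "x \<in> hom C X Q" and t: "trivial C Z (m \<cdot> x)" for X x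
  proof -
    \<comment> \<open>After the pullback, \<open>x \<circ> q'\<close> lifts along \<open>q\<close> to \<open>x'\<close>, which the kernel of \<open>f\<close> absorbs.\<close>
    obtain P x' q' where x': "x' \<in> hom C P A" and q': "q' \<in> hom C P X" and pb: "is_pullback C q x x' q'"
      using pullback_exists[OF finite_limits q x] .
    have sq: "q \<cdot> x' = x \<cdot> q'" using pb by (simp add: is_pullback_def)
    have "q' \<in> NEpi C Z" using pre pb N by (auto simp: prenormal_iff pullback_stable_def)
    have "f \<cdot> x' = m \<cdot> (x \<cdot> q')" unfolding mq[symmetric] sq[symmetric] using m q x' by (simp add: typed_simps)
    also have "\<dots> = (m \<cdot> x) \<cdot> q'" using m x q' by (simp add: typed_simps)
    finally have "trivial C Z (f \<cdot> x')" using trivial_comp_right[OF q' comp_hom[OF x m] t] by simp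
    then obtain u where u: "u \<in> hom C P K" "k \<cdot> u = x'" using un[OF x'] by blast
    have "x \<cdot> q' = (q \<cdot> k) \<cdot> u" unfolding sq[symmetric] u(2)[symmetric] using q k_hom u(1) by (simp add: typed_simps)
    then have "trivial C Z (x \<cdot> q')" using trivial_comp_right[OF u(1) comp_hom[OF k_hom q] qk] by simp
    then show "trivial C Z x"
      by (intro trivial_comp_orthogonal[OF _ q' x] NEpi_TKer_orthogonal \<open>q' \<in> NEpi C Z\<close>)
  qed
  then have "m \<in> TKer C Z" using TKer_iff[OF m] by blast
  then show ?thesis using N q m mq by blast
qed

lemma prenormal_stable_factorisation_system:
  assumes "prenormal C Z"
  shows "stable_factorisation_system C (NEpi C Z) (TKer C Z)"
  unfolding stable_factorisation_system_def factorisation_system_iff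
proof (intro conjI)
  show "\<forall>A B. \<forall>f \<in> hom C A B. \<exists>e \<in> NEpi C Z. \<exists>m \<in> TKer C Z. \<exists>Q.
      e \<in> hom C A Q \<and> m \<in> hom C Q B \<and> f = m \<cdot> e"
    using prenormal_factorisation[OF assms] by simp
  show "\<forall>e \<in> NEpi C Z. \<forall>m \<in> TKer C Z. orthogonal e m" by (simp add: NEpi_TKer_orthogonal)
  show "pullback_stable C (NEpi C Z)" using assms by (simp add: prenormal_iff)
qed (fact NEpi_subset_Arr TKer_subset_Arr iso_closed_NEpi iso_closed_TKer)+

text \<open>Kernels acquire cokernels from the first factor of a factorisation, by
\<open>NEpi_TKer_factor_cokernel\<close>.\<close>

lemma prenormalI:
  assumes fs: "stable_factorisation_system C (NEpi C Z) M" and M: "M \<subseteq> TKer C Z"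
  shows "prenormal C Z"
  unfolding prenormal_iff
proof (intro conjI allI impI)
  show "pullback_stable C (NEpi C Z)" using fs by (simp add: stable_factorisation_system_def)
next
  fix f k assume k: "is_kernel C Z f k"
  then have "f \<in> hom C (Dom C f) (Cod C f)" by (simp add: is_kernel_def hom_def)
  moreover have "\<forall>A B. \<forall>f \<in> hom C A B. \<exists>e \<in> NEpi C Z. \<exists>m \<in> M. \<exists>Q.
      e \<in> hom C A Q \<and> m \<in> hom C Q B \<and> f = m \<cdot> e"
    using fs unfolding stable_factorisation_system_def factorisation_system_iff by simp
  ultimately obtain e m Q where "e \<in> NEpi C Z" "m \<in> TKer C Z" "e \<in> hom C (Dom C f) Q"
    "m \<in> hom C Q (Cod C f)" "f = m \<cdot> e"
    using M by blast
  then show "\<exists>q. is_cokernel C Z k q" using NEpi_TKer_factor_cokernel k by blast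
qed


section \<open>The subreflective case\<close>

text \<open>The universal property only separates arrows into objects of \<open>Z\<close>. Arrows from \<open>Z\<close> into any
\<open>X\<close> factor through the monic counit at \<open>X\<close>, which reduces the general case to that one.\<close>

lemma reflection_epi:
  assumes r: "is_reflection C Z K r" and u: "u \<in> hom C (Cod C r) X" and v: "v \<in> hom C (Cod C r) X"
    and eq: "u \<cdot> r = v \<cdot> r"
  shows "u = v"
proof -
  have r_hom: "r \<in> hom C K (Cod C r)" and R: "Cod C r \<in> Z" using r by (simp_all add: is_reflection_def hom_def)
  obtain W e where W: "W \<in> Z" and e: "e \<in> hom C W X"
    and mono: "\<And>Y u v. u \<in> hom C Y W \<Longrightarrow> v \<in> hom C Y W \<Longrightarrow> e \<cdot> u = e \<cdot> v \<Longrightarrow> u = v"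
    and lift: "\<And>Y x. x \<in> hom C Y X \<Longrightarrow> trivial C Z x \<Longrightarrow> \<exists>u \<in> hom C Y W. e \<cdot> u = x"
    using coreflectionE[of X] hom_objs[OF u] by metis
  have *: "trivial C Z x" if "x \<in> hom C (Cod C r) X" for x
    using trivialI[OF ident_hom R that] that R hom_objs[OF that] by (simp add: typed_simps)
  obtain u' where u': "u' \<in> hom C (Cod C r) W" "e \<cdot> u' = u" using lift[OF u *[OF u]] by blast
  obtain v' where v': "v' \<in> hom C (Cod C r) W" "e \<cdot> v' = v" using lift[OF v *[OF v]] by blast
  have "e \<cdot> (u' \<cdot> r) = u \<cdot> r" "e \<cdot> (v' \<cdot> r) = v \<cdot> r"
    unfolding u'(2)[symmetric] v'(2)[symmetric] using e u'(1) v'(1) r_hom by (simp_all add: typed_simps)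
  then have "u' \<cdot> r = v' \<cdot> r" using mono comp_hom[OF r_hom u'(1)] comp_hom[OF r_hom v'(1)] eq by metis
  then have "u' = v'" using r W u'(1) comp_hom[OF r_hom v'(1)] v'(1) unfolding is_reflection_def by metis
  then show ?thesis using u' v' by simp
qed

text \<open>A reflection of \<open>K\<close> is a cokernel of the identity of \<open>K\<close>: the arrows out of \<open>K\<close> that
trivialise the identity are precisely the trivial ones.\<close>

lemma reflection_NEpi:
  assumes r: "is_reflection C Z K r"
  shows "r \<in> NEpi C Z"
proof -
  have r_hom: "r \<in> hom C K (Cod C r)" and R: "Cod C r \<in> Z" using r by (simp_all add: is_reflection_def hom_def)
  have K: "K \<in> Obj C" using hom_objs[OF r_hom] by simp
  have "is_cokernel C Z (Ident C K) r"
  proof (rule cokernelI[OF ident_hom[OF K] r_hom])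
    show "trivial C Z (r \<cdot> Ident C K)" using trivial_into_Z[OF r_hom R] comp_ident[OF r_hom] by simp
  next
    fix X x assume x: "x \<in> hom C K X" and "trivial C Z (x \<cdot> Ident C K)"
    then have "trivial C Z x" using comp_ident[OF x] by simp
    then obtain W g h where W: "W \<in> Z" and g: "g \<in> hom C K W" and h: "h \<in> hom C W X" and eq: "x = h \<cdot> g"
      using trivialE x by blast
    obtain s where s: "s \<in> hom C (Cod C r) W" "s \<cdot> r = g"
      using r W g unfolding is_reflection_def by blast
    have "(h \<cdot> s) \<cdot> r = x" unfolding eq s(2)[symmetric] using h s(1) r_hom by (simp add: typed_simps)
    then show "\<exists>!u. u \<in> hom C (Cod C r) X \<and> u \<cdot> r = x"
      using comp_hom[OF s(1) h] reflection_epi[OF r] by metis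
  qed
  then show ?thesis by (auto simp: NEpi_def)
qed

context
  assumes subreflective: "subreflective C Z"
begin

text \<open>Subreflectivity is used in this form: the domain of a trivial arrow maps to \<open>Z\<close> and so has a
reflection, which is a normal epimorphism.\<close>

lemma reflectionE:
  assumes g: "g \<in> hom C K W" and W: "W \<in> Z"
  obtains R r where "R \<in> Z" "r \<in> hom C K R" "r \<in> NEpi C Z"
    "\<And>W x. W \<in> Z \<Longrightarrow> x \<in> hom C K W \<Longrightarrow> \<exists>u \<in> hom C R W. u \<cdot> r = x"
proof -
  obtain r where r: "is_reflection C Z K r"
    using subreflective g W hom_objs[OF g] unfolding subreflective_def by blast
  show thesis
  proof (rule that[of "Cod C r" r])
    show "Cod C r \<in> Z" "r \<in> hom C K (Cod C r)" using r by (simp_all add: is_reflection_def hom_def)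
    show "r \<in> NEpi C Z" by (rule reflection_NEpi[OF r])
    show "\<exists>u \<in> hom C (Cod C r) W. u \<cdot> r = x" if "W \<in> Z" "x \<in> hom C K W" for W x
      using r that unfolding is_reflection_def by blast
  qed
qed

text \<open>If \<open>m \<circ> x\<close> is trivial, it factors through the reflection \<open>r\<close> of the domain of \<open>x\<close>. The diagonal
of the resulting square between \<open>r\<close> and \<open>m\<close> factors \<open>x\<close> through the object \<open>R\<close> of \<open>Z\<close>.\<close>

lemma NEpi_orthogonal_TKer:
  assumes orth: "\<And>q. q \<in> NEpi C Z \<Longrightarrow> orthogonal q m" and m: "m \<in> hom C A B"
  shows "m \<in> TKer C Z"
proof -
  have "trivial C Z x" if x: "x \<in> hom C X A" and t: "trivial C Z (m \<cdot> x)" for X x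
  proof -
    obtain W g h where W: "W \<in> Z" and g: "g \<in> hom C X W" and h: "h \<in> hom C W B" and eq: "m \<cdot> x = h \<cdot> g"
      using trivialE[OF t comp_hom[OF x m]] .
    obtain R r s where R: "R \<in> Z" "r \<in> hom C X R" "r \<in> NEpi C Z" and s: "s \<in> hom C R W" "s \<cdot> r = g"
      using reflectionE[OF g W] W g by metis
    have "(h \<cdot> s) \<cdot> r = m \<cdot> x" unfolding eq s(2)[symmetric] using h s(1) R(2) by (simp add: typed_simps)
    then obtain d where "d \<in> hom C R A" "d \<cdot> r = x"
      using orthogonalD[OF orth[OF R(3)] R(2) m x comp_hom[OF s(1) h]] by metis
    then show ?thesis using trivialI[OF R(2,1)] by metis
  qed
  then show ?thesis using TKer_iff[OF m] by blast
qed

text \<open>A trivial \<open>i \<circ> y\<close> factors as \<open>b \<circ> r\<close> through the reflection \<open>r\<close> of \<open>Y\<close>. As \<open>r\<close> is epi, \<open>b\<close>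
equalises \<open>u\<close> and \<open>v\<close>, so \<open>y\<close> factors through \<open>r\<close> as well.\<close>

lemma equalizer_TKer:
  assumes i: "i \<in> hom C I B" and u: "u \<in> hom C B X" and v: "v \<in> hom C B X" and ui: "u \<cdot> i = v \<cdot> i"
    and un: "\<And>Y x. x \<in> hom C Y B \<Longrightarrow> u \<cdot> x = v \<cdot> x \<Longrightarrow> \<exists>!w. w \<in> hom C Y I \<and> i \<cdot> w = x"
  shows "i \<in> TKer C Z"
proof -
  have "trivial C Z y" if y: "y \<in> hom C Y I" and t: "trivial C Z (i \<cdot> y)" for Y y
  proof -
    have iy: "i \<cdot> y \<in> hom C Y B" by (rule comp_hom[OF y i])
    obtain W g h where W: "W \<in> Z" and g: "g \<in> hom C Y W" and h: "h \<in> hom C W B" and eq: "i \<cdot> y = h \<cdot> g"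
      using trivialE[OF t iy] .
    obtain R r s where R: "R \<in> Z" "r \<in> hom C Y R" "r \<in> NEpi C Z" and s: "s \<in> hom C R W" "s \<cdot> r = g"
      using reflectionE[OF g W] W g by metis
    define b where "b = h \<cdot> s"
    have b: "b \<in> hom C R B" unfolding b_def by (rule comp_hom[OF s(1) h])
    have br: "b \<cdot> r = i \<cdot> y" unfolding eq s(2)[symmetric] b_def using h s(1) R(2) by (simp add: typed_simps)
    have "u \<cdot> (i \<cdot> y) = (u \<cdot> i) \<cdot> y" using u i y by (simp add: typed_simps)
    also have "\<dots> = v \<cdot> (i \<cdot> y)" unfolding ui using v i y by (simp add: typed_simps)
    finally have uv: "u \<cdot> (i \<cdot> y) = v \<cdot> (i \<cdot> y)" .
    then have "(u \<cdot> b) \<cdot> r = (v \<cdot> b) \<cdot> r" using u v b R(2) br by (simp add: typed_simps)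
    then have "u \<cdot> b = v \<cdot> b" by (rule NEpi_epi[OF R(3,2) comp_hom[OF b u] comp_hom[OF b v]])
    then obtain j where j: "j \<in> hom C R I" "i \<cdot> j = b" using un[OF b] by blast
    have "i \<cdot> (j \<cdot> r) = b \<cdot> r" unfolding j(2)[symmetric] using i j(1) R(2) by (simp add: typed_simps)
    then have "j \<cdot> r = y" using un[OF iy uv] br comp_hom[OF R(2) j(1)] y by metis
    then show ?thesis using trivialI[OF R(2,1) j(1)] by simp
  qed
  then show ?thesis using TKer_iff[OF i] by blast
qed

text \<open>Products of objects of \<open>Z\<close> may leave \<open>Z\<close>, but both components of \<open>t\<close> factor through the one
reflection of \<open>Y\<close>, and so does their pairing.\<close>

lemma trivial_pair:
  assumes p: "p \<in> hom C P B" and q: "q \<in> hom C P X"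
    and un: "\<And>Y x y. x \<in> hom C Y B \<Longrightarrow> y \<in> hom C Y X \<Longrightarrow> \<exists>!u. u \<in> hom C Y P \<and> p \<cdot> u = x \<and> q \<cdot> u = y"
    and t: "t \<in> hom C Y P" and pt: "trivial C Z (p \<cdot> t)" and qt: "trivial C Z (q \<cdot> t)"
  shows "trivial C Z t"
proof -
  have pth: "p \<cdot> t \<in> hom C Y B" and qth: "q \<cdot> t \<in> hom C Y X"
    by (rule comp_hom[OF t p] comp_hom[OF t q])+
  obtain W g h where W: "W \<in> Z" and g: "g \<in> hom C Y W" and h: "h \<in> hom C W B" and eq: "p \<cdot> t = h \<cdot> g"
    using trivialE[OF pt pth] .
  obtain W' g' h' where W': "W' \<in> Z" and g': "g' \<in> hom C Y W'" and h': "h' \<in> hom C W' X"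
    and eq': "q \<cdot> t = h' \<cdot> g'"
    using trivialE[OF qt qth] .
  obtain R r s s' where R: "R \<in> Z" "r \<in> hom C Y R" and s: "s \<in> hom C R W" "s \<cdot> r = g"
    and s': "s' \<in> hom C R W'" "s' \<cdot> r = g'"
    using reflectionE[OF g W] W g W' g' by metis
  obtain w where w: "w \<in> hom C R P" "p \<cdot> w = h \<cdot> s" "q \<cdot> w = h' \<cdot> s'"
    using un[OF comp_hom[OF s(1) h] comp_hom[OF s'(1) h']] by blast
  have "p \<cdot> (w \<cdot> r) = (p \<cdot> w) \<cdot> r" "q \<cdot> (w \<cdot> r) = (q \<cdot> w) \<cdot> r"
    using p q w(1) R(2) by (simp_all add: typed_simps)
  then have "p \<cdot> (w \<cdot> r) = p \<cdot> t" "q \<cdot> (w \<cdot> r) = q \<cdot> t"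
    unfolding w(2,3) eq eq' s(2)[symmetric] s'(2)[symmetric]
    using h s(1) h' s'(1) R(2) by (simp_all add: typed_simps)
  then have "w \<cdot> r = t" using un[OF pth qth] comp_hom[OF R(2) w(1)] t by metis
  then show ?thesis using trivialI[OF R(2,1) w(1)] by simp
qed

context
  fixes E :: "'a set"
  assumes stable: "stable_factorisation_system C E (TKer C Z)"
begin

lemma E_orthogonal: "e \<in> E \<Longrightarrow> m \<in> TKer C Z \<Longrightarrow> orthogonal e m"
  using stable unfolding stable_factorisation_system_def factorisation_system_iff by blast

lemma E_factorisation:
  assumes "f \<in> hom C A B"
  obtains e m Q where "e \<in> E" "m \<in> TKer C Z" "e \<in> hom C A Q" "m \<in> hom C Q B" "f = m \<cdot> e"
proof -
  have "\<forall>A B. \<forall>f \<in> hom C A B. \<exists>e \<in> E. \<exists>m \<in> TKer C Z. \<exists>Q.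
      e \<in> hom C A Q \<and> m \<in> hom C Q B \<and> f = m \<cdot> e"
    using stable unfolding stable_factorisation_system_def factorisation_system_iff by simp
  then show thesis using assms that by blast
qed

text \<open>The arrow \<open>e\<close> factors through the equaliser of \<open>u\<close> and \<open>v\<close>, which lies in \<open>TKer\<close>; by
orthogonality the equaliser is a split epimorphism, so \<open>u = v\<close>.\<close>

lemma E_epi:
  assumes "e \<in> E" and e: "e \<in> hom C A B" and u: "u \<in> hom C B X" and v: "v \<in> hom C B X"
    and eq: "u \<cdot> e = v \<cdot> e"
  shows "u = v"
proof -
  obtain I i where i: "i \<in> hom C I B" "u \<cdot> i = v \<cdot> i"
    and un: "\<And>Y x. x \<in> hom C Y B \<Longrightarrow> u \<cdot> x = v \<cdot> x \<Longrightarrow> \<exists>!w. w \<in> hom C Y I \<and> i \<cdot> w = x"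
    using equalizer_exists[OF finite_limits u v] by metis
  have iT: "i \<in> TKer C Z" by (rule equalizer_TKer[OF i(1) u v i(2) un])
  have B: "Ident C B \<in> hom C B B" using ident_hom hom_objs[OF e] by simp
  obtain e' where e': "e' \<in> hom C A I" "i \<cdot> e' = e" using un[OF e eq] by blast
  obtain d where d: "d \<in> hom C B I" "i \<cdot> d = Ident C B"
    using orthogonalD[OF E_orthogonal[OF assms(1) iT] e i(1) e'(1) B] e'(2) ident_comp[OF e] by metis
  have "u = u \<cdot> (i \<cdot> d)" using d comp_ident[OF u] by simp
  also have "\<dots> = (u \<cdot> i) \<cdot> d" using u i(1) d(1) by (simp add: typed_simps)
  also have "\<dots> = v \<cdot> (i \<cdot> d)" unfolding i(2) using v i(1) d(1) by (simp add: typed_simps)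
  also have "\<dots> = v" using d comp_ident[OF v] by simp
  finally show ?thesis .
qed

text \<open>Let \<open>h = \<langle>e, x\<rangle>\<close> with factorisation \<open>m \<circ> q\<close>, and let \<open>g\<close> be the first component of \<open>m\<close>, so
that \<open>g \<circ> q = e\<close>. By the hypothesis on \<open>x\<close> and \<open>trivial_pair\<close>, \<open>h\<close> trivialises whatever \<open>e\<close> does.
With stability of \<open>E\<close> this shows that \<open>g\<close> reflects triviality, so \<open>e\<close> is orthogonal to \<open>g\<close>. The
diagonal \<open>d\<close> satisfies \<open>d \<circ> e = q\<close>, and the second component of \<open>m\<close> composed with \<open>d\<close> is the
required arrow.\<close>

lemma E_factors:
  assumes eE: "e \<in> E" and e: "e \<in> hom C A B" and x: "x \<in> hom C A X"
    and t: "\<And>Y y. y \<in> hom C Y A \<Longrightarrow> trivial C Z (e \<cdot> y) \<Longrightarrow> trivial C Z (x \<cdot> y)"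
  shows "\<exists>u \<in> hom C B X. u \<cdot> e = x"
proof -
  have objs: "B \<in> Obj C" "X \<in> Obj C" using hom_objs[OF e] hom_objs[OF x] by simp_all
  obtain P p1 p2 where p1: "p1 \<in> hom C P B" and p2: "p2 \<in> hom C P X"
    and un: "\<And>Y x y. x \<in> hom C Y B \<Longrightarrow> y \<in> hom C Y X \<Longrightarrow>
      \<exists>!u. u \<in> hom C Y P \<and> p1 \<cdot> u = x \<and> p2 \<cdot> u = y"
    by (rule product_exists[OF finite_limits objs]) (rule that, assumption, assumption, blast)
  obtain h where h: "h \<in> hom C A P" "p1 \<cdot> h = e" "p2 \<cdot> h = x" using un[OF e x] by blast
  obtain q m Q where qE: "q \<in> E" and mT: "m \<in> TKer C Z" and q: "q \<in> hom C A Q" and m: "m \<in> hom C Q P"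
    and mq: "h = m \<cdot> q"
    using E_factorisation[OF h(1)] .
  define g where "g = p1 \<cdot> m"
  have g: "g \<in> hom C Q B" unfolding g_def by (rule comp_hom[OF m p1])
  have gq: "g \<cdot> q = e" unfolding h(2)[symmetric] mq g_def using p1 m q by (simp add: typed_simps)
  have "trivial C Z y" if y: "y \<in> hom C Y Q" and gy: "trivial C Z (g \<cdot> y)" for Y y
  proof -
    obtain R y' q' where y': "y' \<in> hom C R A" and q': "q' \<in> hom C R Y" and pb: "is_pullback C q y y' q'"
      using pullback_exists[OF finite_limits q y] .
    have sq: "q \<cdot> y' = y \<cdot> q'" using pb by (simp add: is_pullback_def)
    have q'E: "q' \<in> E" using stable pb qE by (auto simp: stable_factorisation_system_def pullback_stable_def)
    have "e \<cdot> y' = g \<cdot> (y \<cdot> q')" unfolding gq[symmetric] sq[symmetric] using g q y' by (simp add: typed_simps)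
    also have "\<dots> = (g \<cdot> y) \<cdot> q'" using g y q' by (simp add: typed_simps)
    finally have ey': "trivial C Z (e \<cdot> y')" using trivial_comp_right[OF q' comp_hom[OF y g] gy] by simp
    have hy': "h \<cdot> y' \<in> hom C R P" by (rule comp_hom[OF y' h(1)])
    have "p1 \<cdot> (h \<cdot> y') = e \<cdot> y'" "p2 \<cdot> (h \<cdot> y') = x \<cdot> y'"
      unfolding h(2)[symmetric] h(3)[symmetric] using p1 p2 h(1) y' by (simp_all add: typed_simps)
    then have "trivial C Z (h \<cdot> y')" using trivial_pair[OF p1 p2 un hy'] ey' t[OF y' ey'] by simp
    moreover have "h \<cdot> y' = m \<cdot> (y \<cdot> q')" unfolding mq sq[symmetric] using m q y' by (simp add: typed_simps)
    ultimately have "trivial C Z (y \<cdot> q')" using trivial_TKer_comp[OF mT m comp_hom[OF q' y]] by simp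
    then show ?thesis by (intro trivial_comp_orthogonal[OF _ q' y] E_orthogonal q'E)
  qed
  then have gT: "g \<in> TKer C Z" using TKer_iff[OF g] by blast
  have B: "Ident C B \<in> hom C B B" using ident_hom hom_objs[OF e] by simp
  obtain d where d: "d \<in> hom C B Q" "d \<cdot> e = q"
    using orthogonalD[OF E_orthogonal[OF eE gT] e g q B] gq ident_comp[OF e] by metis
  have "((p2 \<cdot> m) \<cdot> d) \<cdot> e = (p2 \<cdot> m) \<cdot> (d \<cdot> e)" using p2 m d(1) e by (simp add: typed_simps)
  also have "\<dots> = x" unfolding d(2) h(3)[symmetric] mq using p2 m q by (simp add: typed_simps)
  finally show ?thesis using comp_hom[OF d(1) comp_hom[OF m p2]] by blast
qed

lemma E_subset_NEpi: "E \<subseteq> NEpi C Z"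
proof
  fix e assume eE: "e \<in> E"
  then have e: "e \<in> hom C (Dom C e) (Cod C e)"
    using stable by (auto simp: stable_factorisation_system_def factorisation_system_def hom_def)
  show "e \<in> NEpi C Z" by (rule NEpiI[OF e]) (use E_epi[OF eE e] E_factors[OF eE e] in blast)+
qed

text \<open>Factorise \<open>q = m \<circ> e\<close>. As \<open>q\<close> is orthogonal to \<open>m\<close>, the arrow \<open>m\<close> has a section \<open>d\<close> with
\<open>d \<circ> q = e\<close>, and \<open>m\<close> is invertible since \<open>e\<close> is epi.\<close>

lemma NEpi_subset_E: "NEpi C Z \<subseteq> E"
proof
  fix q assume qN: "q \<in> NEpi C Z"
  then have q: "q \<in> hom C (Dom C q) (Cod C q)" using NEpi_subset_Arr by (auto simp: hom_def)
  obtain e m Q where eE: "e \<in> E" and mT: "m \<in> TKer C Z" and e: "e \<in> hom C (Dom C q) Q"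
    and m: "m \<in> hom C Q (Cod C q)" and me: "q = m \<cdot> e"
    using E_factorisation[OF q] .
  have B: "Ident C (Cod C q) \<in> hom C (Cod C q) (Cod C q)" using ident_hom hom_objs[OF q] by simp
  obtain d where d: "d \<in> hom C (Cod C q) Q" "d \<cdot> q = e" "m \<cdot> d = Ident C (Cod C q)"
    using orthogonalD[OF NEpi_TKer_orthogonal[OF qN mT] q m e B] me ident_comp[OF q] by metis
  have Q: "Ident C Q \<in> hom C Q Q" using ident_hom hom_objs[OF m] by simp
  have "(d \<cdot> m) \<cdot> e = d \<cdot> q" unfolding me using d(1) m e by (simp add: typed_simps)
  then have "d \<cdot> m = Ident C Q"
    using E_epi[OF eE e comp_hom[OF m d(1)] Q] d(2) ident_comp[OF e] by simp
  then have "is_iso C m" using m d by (auto simp: is_iso_def hom_def)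
  moreover have "iso_closed C E"
    using stable by (simp add: stable_factorisation_system_def factorisation_system_def)
  ultimately have "m \<cdot> e \<in> E" using eE m e by (simp add: iso_closed_def hom_def)
  then show "q \<in> E" using me by simp
qed

lemma E_eq_NEpi: "E = NEpi C Z"
  using E_subset_NEpi NEpi_subset_E by blast

end

end

end

theorem proposition5p1:
  fixes C :: "('o, 'a) cat" and Z :: "'o set"
  assumes "category C"
    and "has_finite_limits C"
    and "mono_coreflective C Z"
  shows "(prenormal C Z \<longleftrightarrow> stable_factorisation_system C (NEpi C Z) (TKer C Z)) \<and>
    (subreflective C Z \<longrightarrow>
      (prenormal C Z \<longleftrightarrow> (\<exists>M. stable_factorisation_system C (NEpi C Z) M)) \<and>
      (prenormal C Z \<longleftrightarrow> (\<exists>E. stable_factorisation_system C E (TKer C Z))))"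
proof -
  interpret mono_coreflective_subcategory C Z
    by (intro mono_coreflective_subcategory.intro mono_coreflective_subcategory_axioms.intro assms)
  have i_ii: "prenormal C Z \<longleftrightarrow> stable_factorisation_system C (NEpi C Z) (TKer C Z)"
    using prenormal_stable_factorisation_system prenormalI[OF _ subset_refl] by blast
  have iii_i: "prenormal C Z"
    if sub: "subreflective C Z" and fs: "stable_factorisation_system C (NEpi C Z) M" for M
  proof (rule prenormalI[OF fs], rule subsetI)
    fix m assume m: "m \<in> M"
    have "M \<subseteq> Arr C" and orth: "\<forall>e \<in> NEpi C Z. \<forall>m \<in> M. orthogonal e m"
      using fs unfolding stable_factorisation_system_def factorisation_system_iff by simp_all
    then have "m \<in> hom C (Dom C m) (Cod C m)" using m by (auto simp: hom_def)
    then show "m \<in> TKer C Z" using NEpi_orthogonal_TKer[OF sub] orth m by blast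
  qed
  have iv_ii: "stable_factorisation_system C (NEpi C Z) (TKer C Z)"
    if sub: "subreflective C Z" and fs: "stable_factorisation_system C E (TKer C Z)" for E
    using fs unfolding E_eq_NEpi[OF sub fs] .
  show ?thesis
  proof (intro conjI impI)
    show "prenormal C Z \<longleftrightarrow> stable_factorisation_system C (NEpi C Z) (TKer C Z)" by (rule i_ii)
  next
    assume sub: "subreflective C Z"
    show "prenormal C Z \<longleftrightarrow> (\<exists>M. stable_factorisation_system C (NEpi C Z) M)"
      using i_ii iii_i[OF sub] by blast
    show "prenormal C Z \<longleftrightarrow> (\<exists>E. stable_factorisation_system C E (TKer C Z))"
      using i_ii iv_ii[OF sub] by blast
  qed
qed

end
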